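(* For $n\ge 3$ let $D_n$ be the dihedral group of order $2n$. If $n$ is even with $n\geq 4$, then $$\mathrm{AM}_{\mathrm Z}(D_n) = 1 + 3\left(1-\frac{2}{n}\right)^2,$$ and if $n$ is odd with $n\geq 3$, then $$\mathrm{AM}_{\mathrm Z}(D_n) = 1 + 3\left(1-\frac{1}{n}\right)^2.$$
   Context: $D_n = \langle r,t \mid r^n = t^2 = 1,\ tr = r^{-1}t\rangle$. All characters are complex characters. For a finite group $G$: $\mathrm{Irr}(G)$ is the set of irreducible characters of $G$, $d_\chi$ is the degree of $\chi$, $\mathrm{Conj}(G)$ is the set of conjugacy classes of $G$, and $\chi(C)$ is the common value of $\chi$ on the elements of a conjugacy class $C$. The ZL-amenability constant of a finite group $G$ (the amenability constant of the centre of $\ell^1(G)$) is $$\mathrm{AM}_{\mathrm Z}(G) = \frac{1}{|G|^2}\sum_{C,D\in \mathrm{Conj}(G)} \left| \sum_{\chi\in \mathrm{Irr}(G)} d_\chi^2\, \chi(C)\overline{\chi(D)} \right| \, |C|\,|D|.$$ *)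

theory Defs
  imports "HOL-Algebra.Group_Action" "Jordan_Normal_Form.VS_Connect"
begin

section \<open>Groups given by a presentation\<close>

text \<open>A word is a list of letters; \<open>(x, True)\<close> stands for the generator \<open>x\<close> and
  \<open>(x, False)\<close> for its formal inverse. Every \<open>(u, v) \<in> R\<close> is a relation \<open>u = v\<close>.\<close>

type_synonym 'a gword = "('a \<times> bool) list"

inductive gword_eq :: "('a gword \<times> 'a gword) set \<Rightarrow> 'a gword \<Rightarrow> 'a gword \<Rightarrow> bool"
  for R where
  relator: "(u, v) \<in> R \<Longrightarrow> gword_eq R u v"
| cancel: "gword_eq R [(x, b), (x, \<not> b)] []"
| refl: "gword_eq R u u"
| sym: "gword_eq R u v \<Longrightarrow> gword_eq R v u"
| trans: "gword_eq R u v \<Longrightarrow> gword_eq R v w \<Longrightarrow> gword_eq R u w"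
| append: "gword_eq R u u' \<Longrightarrow> gword_eq R v v' \<Longrightarrow> gword_eq R (u @ v) (u' @ v')"

definition gword_class :: "('a gword \<times> 'a gword) set \<Rightarrow> 'a gword \<Rightarrow> 'a gword set" where
  "gword_class R u = {v. gword_eq R u v}"

definition presented_group :: "('a gword \<times> 'a gword) set \<Rightarrow> 'a gword set monoid" where
  "presented_group R =
    \<lparr>carrier = range (gword_class R),
     mult = (\<lambda>A B. \<Union>u\<in>A. \<Union>v\<in>B. gword_class R (u @ v)),
     one = gword_class R []\<rparr>"

lemma gword_class_eq_iff: "gword_class R u = gword_class R v \<longleftrightarrow> gword_eq R u v"
  unfolding gword_class_def
  by (metis (mono_tags, lifting) Collect_cong gword_eq.refl gword_eq.sym gword_eq.trans mem_Collect_eq)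

lemma carrier_presented_group: "carrier (presented_group R) = range (gword_class R)"
  and one_presented_group: "\<one>\<^bsub>presented_group R\<^esub> = gword_class R []"
  by (simp_all add: presented_group_def)

lemma mult_presented_group:
  "gword_class R u \<otimes>\<^bsub>presented_group R\<^esub> gword_class R v = gword_class R (u @ v)"
proof -
  have "gword_class R (u' @ v') = gword_class R (u @ v)"
    if "u' \<in> gword_class R u" "v' \<in> gword_class R v" for u' v'
    unfolding gword_class_eq_iff
    using that[unfolded gword_class_def mem_Collect_eq]
    by (intro gword_eq.append gword_eq.sym[of R u] gword_eq.sym[of R v])
  moreover have "gword_class R w \<noteq> {}" for w
    using gword_eq.refl[of R w] by (auto simp: gword_class_def)
  ultimately have
    "(\<Union>u'\<in>gword_class R u. \<Union>v'\<in>gword_class R v. gword_class R (u' @ v')) = gword_class R (u @ v)"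
    by (intro SUP_eq_const)
  then show ?thesis
    by (simp add: presented_group_def)
qed

lemma gword_inverse:
  "gword_eq R (map (\<lambda>(x, b). (x, \<not> b)) (rev u) @ u) []"
proof (induction u)
  case Nil
  show ?case by (simp add: gword_eq.refl)
next
  case (Cons a u)
  obtain x b where a: "a = (x, b)" by (cases a)
  let ?v = "map (\<lambda>(x, b). (x, \<not> b)) (rev u)"
  have "gword_eq R [(x, \<not> b), (x, b)] []"
    using gword_eq.cancel[of R x "\<not> b"] by simp
  from gword_eq.append[OF gword_eq.refl[of R ?v] gword_eq.append[OF this gword_eq.refl[of R u]]]
  have "gword_eq R (?v @ [(x, \<not> b), (x, b)] @ u) (?v @ u)" by simp
  from gword_eq.trans[OF this Cons.IH] show ?case by (simp add: a)
qed

lemma group_presented_group: "group (presented_group R)"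
proof (rule groupI)
  fix A assume "A \<in> carrier (presented_group R)"
  then obtain u where "A = gword_class R u" by (auto simp: carrier_presented_group)
  with gword_inverse[of R u]
  show "\<exists>B\<in>carrier (presented_group R). B \<otimes>\<^bsub>presented_group R\<^esub> A = \<one>\<^bsub>presented_group R\<^esub>"
    by (metis carrier_presented_group gword_class_eq_iff mult_presented_group
        one_presented_group rangeI)
qed (auto simp: carrier_presented_group one_presented_group mult_presented_group)


section \<open>The dihedral groups\<close>

datatype dihedral_gen = Rot | Ref

definition dihedral_relations :: "nat \<Rightarrow> (dihedral_gen gword \<times> dihedral_gen gword) set" where
  "dihedral_relations n =
    {(replicate n (Rot, True), []),
     ([(Ref, True), (Ref, True)], []),
     ([(Ref, True), (Rot, True)], [(Rot, False), (Ref, True)])}"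

definition dihedral_group :: "nat \<Rightarrow> dihedral_gen gword set monoid" where
  "dihedral_group n = presented_group (dihedral_relations n)"

text \<open>To separate the elements, a word is evaluated to the affine map
  \<open>x \<mapsto> s * x + k\<close>, stored as \<open>(k, s)\<close>; here \<open>Rot\<close> is \<open>x \<mapsto> x + 1\<close> and \<open>Ref\<close> is \<open>x \<mapsto> - x\<close>.\<close>

fun dihedral_val :: "dihedral_gen gword \<Rightarrow> int \<times> int" where
  "dihedral_val [] = (0, 1)"
| "dihedral_val ((Rot, b) # w) =
    (case dihedral_val w of (k, s) \<Rightarrow> (if b then k + 1 else k - 1, s))"
| "dihedral_val ((Ref, b) # w) = (case dihedral_val w of (k, s) \<Rightarrow> (- k, - s))"

lemma dihedral_val_append:
  "dihedral_val (u @ v) =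
    (fst (dihedral_val u) + snd (dihedral_val u) * fst (dihedral_val v),
     snd (dihedral_val u) * snd (dihedral_val v))"
  by (induction u rule: dihedral_val.induct) (auto split: prod.splits simp: algebra_simps)

lemma dihedral_val_replicate: "dihedral_val (replicate k (Rot, True)) = (int k, 1)"
  by (induction k) auto

lemma dihedral_val_gword_eq:
  assumes "gword_eq (dihedral_relations n) u v"
  shows "fst (dihedral_val u) mod int n = fst (dihedral_val v) mod int n
    \<and> snd (dihedral_val u) = snd (dihedral_val v)"
  using assms
proof (induction rule: gword_eq.induct)
  case (relator u v)
  then show ?case by (auto simp: dihedral_relations_def dihedral_val_replicate)
next
  case (cancel x b)
  then show ?case by (cases x; cases b) auto
next
  case (append u u' v v')
  let ?f = "\<lambda>w. fst (dihedral_val w)" and ?s = "\<lambda>w. snd (dihedral_val w)"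
  from append.IH have "(?f u + ?s u * ?f v) mod int n = (?f u' + ?s u * ?f v') mod int n"
    by (blast intro: mod_add_cong mod_mult_cong)
  with append.IH show ?case
    by (simp add: dihedral_val_append)
qed auto

lemma order_dihedral_group:
  assumes "n > 0"
  shows "Coset.order (dihedral_group n) = 2 * n"
proof -
  let ?R = "dihedral_relations n"
  let ?cl = "gword_class ?R"
  define f where "f = (\<lambda>(k, b). ?cl (replicate k (Rot, True) @ (if b then [(Ref, True)] else [])))"
  interpret G: group "dihedral_group n"
    unfolding dihedral_group_def by (rule group_presented_group)
  have cl_carrier: "?cl u \<in> carrier (dihedral_group n)" for u
    by (simp add: dihedral_group_def carrier_presented_group)
  have cl_mult: "?cl u \<otimes>\<^bsub>dihedral_group n\<^esub> ?cl v = ?cl (u @ v)" for u v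
    by (simp add: dihedral_group_def mult_presented_group)
  have cl_one: "\<one>\<^bsub>dihedral_group n\<^esub> = ?cl []"
    by (simp add: dihedral_group_def one_presented_group)
  have ctxt: "?cl (p @ u @ q) = ?cl (p @ v @ q)" if "?cl u = ?cl v" for p q u v
    using that by (metis cl_mult)
  have rn: "?cl (replicate n (Rot, True)) = ?cl []"
    and tt: "?cl [(Ref, True), (Ref, True)] = ?cl []"
    and tr: "?cl [(Ref, True), (Rot, True)] = ?cl [(Rot, False), (Ref, True)]"
    unfolding gword_class_eq_iff by (auto intro: gword_eq.relator simp: dihedral_relations_def)
  have canc: "?cl [(x, b), (x, \<not> b)] = ?cl []" for x b
    unfolding gword_class_eq_iff by (rule gword_eq.cancel)
  have rinv: "?cl [(Rot, False)] = ?cl (replicate (n - 1) (Rot, True))"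
  proof -
    have "?cl [(Rot, False)] = ?cl ([(Rot, False)] @ replicate n (Rot, True))"
      using ctxt[OF rn, of "[(Rot, False)]" "[]"] by simp
    also have "\<dots> = ?cl ([] @ [(Rot, False), (Rot, True)] @ replicate (n - 1) (Rot, True))"
      using assms by (cases n) auto
    also have "\<dots> = ?cl (replicate (n - 1) (Rot, True))"
      using ctxt[OF canc[of Rot False], of "[]" "replicate (n - 1) (Rot, True)"] by simp
    finally show ?thesis .
  qed
  have tinv: "?cl [(Ref, False)] = ?cl [(Ref, True)]"
    using ctxt[OF tt, of "[(Ref, False)]" "[]"] ctxt[OF canc[of Ref False], of "[]" "[(Ref, True)]"]
    by simp
  have range_f: "range f = f ` ({..<n} \<times> UNIV)"
  proof -
    have "f (k, b) = f (k mod n, b)" for k b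
    proof (induction k rule: less_induct)
      case (less k)
      show ?case
      proof (cases "k < n")
        case False
        then have "replicate k (Rot, True) = replicate n (Rot, True) @ replicate (k - n) (Rot, True)"
          by (simp flip: replicate_add)
        then have "f (k, b) = f (k - n, b)"
          using ctxt[OF rn, of "[]"] by (simp add: f_def)
        with less[of "k - n"] False assms show ?thesis by (simp add: le_mod_geq)
      qed simp
    qed
    then have "f (k, b) \<in> f ` ({..<n} \<times> UNIV)" for k b
      using assms by (auto intro!: image_eqI[of _ f "(k mod n, b)"])
    then show ?thesis by auto
  qed
  have rot: "?cl ((Rot, True) # u) \<in> range f" if "?cl u \<in> range f" for u
  proof -
    from that obtain k b where "?cl u = f (k, b)" by auto
    with ctxt[of u _ "[(Rot, True)]" "[]"] have "?cl ((Rot, True) # u) = f (Suc k, b)"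
      by (simp add: f_def)
    then show ?thesis by blast
  qed
  have rots: "?cl (replicate k (Rot, True) @ u) \<in> range f" if "?cl u \<in> range f" for u k
    using that by (induction k) (auto intro: rot)
  have rot': "?cl ((Rot, False) # u) \<in> range f" if "?cl u \<in> range f" for u
    using rots[OF that, of "n - 1"] ctxt[OF rinv, of "[]" u] by simp
  have ref: "?cl ((Ref, True) # replicate k (Rot, True) @ (if b then [(Ref, True)] else [])) \<in> range f"
    for k b
  proof (induction k)
    case 0
    have "?cl [(Ref, True)] = f (0, True)" "?cl [(Ref, True), (Ref, True)] = f (0, False)"
      by (simp_all add: f_def tt)
    then show ?case by (cases b) auto
  next
    case (Suc k)
    from rot'[OF this] show ?case
      using ctxt[OF tr, of "[]" "replicate k (Rot, True) @ (if b then [(Ref, True)] else [])"]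
      by simp
  qed
  have ref': "?cl ((Ref, True) # u) \<in> range f" if "?cl u \<in> range f" for u
  proof -
    from that obtain k b where "?cl u = f (k, b)" by auto
    with ref[of k b] ctxt[of u _ "[(Ref, True)]" "[]"] show ?thesis by (simp add: f_def)
  qed
  have "?cl u \<in> range f" for u
  proof (induction u)
    case Nil
    have "?cl [] = f (0, False)" by (simp add: f_def)
    then show ?case by blast
  next
    case (Cons a u)
    show ?case
    proof (cases a)
      case (Pair x b)
      with Cons show ?thesis
        using rot[of u] rot'[of u] ref'[of u] ctxt[OF tinv, of "[]" u] by (cases x; cases b) simp_all
    qed
  qed
  then have "carrier (dihedral_group n) = f ` ({..<n} \<times> UNIV)"
    unfolding range_f[symmetric]
    by (auto simp: dihedral_group_def carrier_presented_group f_def)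
  moreover have "inj_on f ({..<n} \<times> UNIV)"
  proof (rule inj_onI, clarsimp)
    fix k b l c assume "k < n" "l < n" "f (k, b) = f (l, c)"
    then have "gword_eq ?R (replicate k (Rot, True) @ (if b then [(Ref, True)] else []))
      (replicate l (Rot, True) @ (if c then [(Ref, True)] else []))"
      by (simp add: f_def gword_class_eq_iff)
    from dihedral_val_gword_eq[OF this] \<open>k < n\<close> \<open>l < n\<close>
    show "k = l \<and> b = c"
      by (cases b; cases c) (auto simp: dihedral_val_append dihedral_val_replicate)
  qed
  ultimately show ?thesis
    unfolding Coset.order_def by (simp add: card_image card_cartesian_product)
qed


section \<open>Complex characters\<close>

abbreviation GL :: "nat \<Rightarrow> complex mat monoid" where
  "GL d \<equiv> units_of (ring_mat TYPE(complex) d ())"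

definition representation ::
  "('g, 'b) monoid_scheme \<Rightarrow> nat \<Rightarrow> ('g \<Rightarrow> complex mat) \<Rightarrow> bool" where
  "representation G d \<rho> \<longleftrightarrow> \<rho> \<in> hom G (GL d)"

definition invariant_subspace ::
  "('g, 'b) monoid_scheme \<Rightarrow> nat \<Rightarrow> ('g \<Rightarrow> complex mat) \<Rightarrow> complex vec set \<Rightarrow> bool" where
  "invariant_subspace G d \<rho> W \<longleftrightarrow>
    VectorSpace.subspace class_ring W (module_vec TYPE(complex) d) \<and>
    (\<forall>g\<in>carrier G. \<forall>w\<in>W. \<rho> g *\<^sub>v w \<in> W)"

definition irreducible_representation ::
  "('g, 'b) monoid_scheme \<Rightarrow> nat \<Rightarrow> ('g \<Rightarrow> complex mat) \<Rightarrow> bool" where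
  "irreducible_representation G d \<rho> \<longleftrightarrow>
    representation G d \<rho> \<and> d > 0 \<and>
    (\<forall>W. invariant_subspace G d \<rho> W \<longrightarrow> W = {0\<^sub>v d} \<or> W = carrier_vec d)"

definition mat_trace :: "'a::comm_monoid_add mat \<Rightarrow> 'a" where
  "mat_trace A = (\<Sum>i<dim_row A. A $$ (i, i))"

text \<open>The restriction to the carrier makes distinct characters differ on the carrier, so that
  \<open>Irr G\<close> contains every irreducible character exactly once.\<close>

definition char_of_rep ::
  "('g, 'b) monoid_scheme \<Rightarrow> ('g \<Rightarrow> complex mat) \<Rightarrow> 'g \<Rightarrow> complex" where
  "char_of_rep G \<rho> = (\<lambda>g\<in>carrier G. mat_trace (\<rho> g))"

definition Irr :: "('g, 'b) monoid_scheme \<Rightarrow> ('g \<Rightarrow> complex) set" where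
  "Irr G = {char_of_rep G \<rho> | \<rho> d. irreducible_representation G d \<rho>}"

definition char_degree :: "('g, 'b) monoid_scheme \<Rightarrow> ('g \<Rightarrow> complex) \<Rightarrow> complex" where
  "char_degree G \<chi> = \<chi> \<one>\<^bsub>G\<^esub>"

lemma char_degree_char_of_rep:
  assumes "group G" and "representation G d \<rho>"
  shows "char_degree G (char_of_rep G \<rho>) = of_nat d"
proof -
  interpret M: ring "ring_mat TYPE(complex) d ()" by (rule ring_mat)
  have "\<rho> \<one>\<^bsub>G\<^esub> = \<one>\<^bsub>GL d\<^esub>"
    using hom_one[of \<rho> G "GL d"] assms M.units_group by (simp add: representation_def)
  then have "\<rho> \<one>\<^bsub>G\<^esub> = 1\<^sub>m d"
    by (simp add: units_of_one ring_mat_simps)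
  then show ?thesis
    using assms(1)
    by (simp add: char_degree_def char_of_rep_def mat_trace_def group.is_monoid monoid.one_closed)
qed


section \<open>The ZL-amenability constant\<close>

definition Conj :: "('g, 'b) monoid_scheme \<Rightarrow> 'g set set" where
  "Conj G = orbits G (carrier G) (\<lambda>h. \<lambda>g\<in>carrier G. h \<otimes>\<^bsub>G\<^esub> g \<otimes>\<^bsub>G\<^esub> inv\<^bsub>G\<^esub> h)"

definition class_value :: "('g \<Rightarrow> complex) \<Rightarrow> 'g set \<Rightarrow> complex" where
  "class_value \<chi> C = the_elem (\<chi> ` C)"

lemma mat_trace_comm:
  fixes A B :: "'a::comm_semiring_0 mat"
  assumes "A \<in> carrier_mat d d" "B \<in> carrier_mat d d"
  shows "mat_trace (A * B) = mat_trace (B * A)"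
proof -
  have "mat_trace (A * B) = (\<Sum>i<d. \<Sum>j<d. A $$ (i, j) * B $$ (j, i))"
    and "mat_trace (B * A) = (\<Sum>i<d. \<Sum>j<d. B $$ (i, j) * A $$ (j, i))"
    using assms by (auto simp: mat_trace_def scalar_prod_def atLeast0LessThan intro!: sum.cong)
  then show ?thesis
    by (simp add: mult.commute sum.swap[of "\<lambda>i j. A $$ (i, j) * B $$ (j, i)"])
qed

lemma class_value_char_of_rep:
  assumes "group G" and \<rho>: "representation G d \<rho>" and C: "C \<in> Conj G" "x \<in> C"
  shows "class_value (char_of_rep G \<rho>) C = char_of_rep G \<rho> x"
proof -
  interpret group G by fact
  interpret M: ring "ring_mat TYPE(complex) d ()" by (rule ring_mat)
  have hom: "\<rho> (g \<otimes>\<^bsub>G\<^esub> h) = \<rho> g * \<rho> h" if "g \<in> carrier G" "h \<in> carrier G" for g h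
    using hom_mult[OF \<rho>[unfolded representation_def] that] by (simp add: units_of_mult ring_mat_simps)
  have mat: "\<rho> g \<in> carrier_mat d d" if "g \<in> carrier G" for g
    using hom_in_carrier[OF \<rho>[unfolded representation_def] that] M.Units_closed
    by (auto simp: units_of_carrier ring_mat_simps)
  from C obtain y where y: "y \<in> carrier G"
    and C_eq: "C = {h \<otimes>\<^bsub>G\<^esub> y \<otimes>\<^bsub>G\<^esub> inv\<^bsub>G\<^esub> h | h. h \<in> carrier G}"
    by (auto simp: Conj_def orbits_def orbit_def)
  have "char_of_rep G \<rho> (h \<otimes>\<^bsub>G\<^esub> y \<otimes>\<^bsub>G\<^esub> inv\<^bsub>G\<^esub> h) = char_of_rep G \<rho> y" if h: "h \<in> carrier G" for h
  proof -
    have "mat_trace (\<rho> (h \<otimes>\<^bsub>G\<^esub> y \<otimes>\<^bsub>G\<^esub> inv\<^bsub>G\<^esub> h)) = mat_trace (\<rho> (h \<otimes>\<^bsub>G\<^esub> y) * \<rho> (inv\<^bsub>G\<^esub> h))"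
      using h y by (simp add: hom)
    also have "\<dots> = mat_trace (\<rho> (inv\<^bsub>G\<^esub> h) * \<rho> (h \<otimes>\<^bsub>G\<^esub> y))"
      using h y by (intro mat_trace_comm[of _ d] mat) auto
    also have "\<dots> = mat_trace (\<rho> (inv\<^bsub>G\<^esub> h \<otimes>\<^bsub>G\<^esub> (h \<otimes>\<^bsub>G\<^esub> y)))"
      using h y by (simp add: hom[of "inv\<^bsub>G\<^esub> h" "h \<otimes>\<^bsub>G\<^esub> y"])
    finally show ?thesis
      using h y by (simp add: char_of_rep_def m_assoc[symmetric])
  qed
  then have "char_of_rep G \<rho> z = char_of_rep G \<rho> y" if "z \<in> C" for z
    using that by (auto simp: C_eq)
  with C(2) have "char_of_rep G \<rho> ` C = {char_of_rep G \<rho> x}" by auto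
  then show ?thesis by (simp add: class_value_def)
qed

definition AM_Z :: "('g, 'b) monoid_scheme \<Rightarrow> real" where
  "AM_Z G = 1 / (real (Coset.order G))\<^sup>2 *
    (\<Sum>C\<in>Conj G. \<Sum>D\<in>Conj G.
      cmod (\<Sum>\<chi>\<in>Irr G. (char_degree G \<chi>)\<^sup>2 * class_value \<chi> C * cnj (class_value \<chi> D))
        * real (card C) * real (card D))"

end

theory Submission
  imports Defs "Jordan_Normal_Form.Spectral_Radius"
begin

text \<open>As characters are class functions, the double sum over conjugacy classes is a double sum over
  group elements. The irreducible characters of \<open>D\<^sub>n\<close> are the linear ones
  \<open>r^k t^b \<mapsto> \<alpha>^k \<beta>^b\<close> with \<open>\<alpha>^n = \<alpha>^2 = \<beta>^2 = 1\<close>, and for each pair \<open>{z, z^-1}\<close> of \<open>n\<close>-th roots of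
  unity with \<open>z^2 \<noteq> 1\<close> the character of degree \<open>2\<close> that sends \<open>r^k\<close> to \<open>z^k + z^-k\<close> and vanishes
  on reflections. With \<open>m = gcd n 2\<close>, orthogonality of roots of unity turns the inner sum into
  \<open>4n([n | k + l] + [n | k - l]) - 6m[m | k + l]\<close> for the rotations \<open>r^k, r^l\<close>, into \<open>2m[m | k + l]\<close> for
  the reflections \<open>r^k t, r^l t\<close>, and into \<open>0\<close> for a rotation and a reflection. The absolute values add up to
  \<open>16n^2 - 24mn + 12m^2\<close>.\<close>

section \<open>Matrix representations\<close>

lemma representation_carrier_mat:
  assumes "representation G d \<rho>" "g \<in> carrier G"
  shows "\<rho> g \<in> carrier_mat d d"
proof -
  interpret M: ring "ring_mat TYPE(complex) d ()" by (rule ring_mat)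
  show ?thesis
    using hom_in_carrier[OF assms(1)[unfolded representation_def] assms(2)] M.Units_closed
    by (auto simp: units_of_carrier ring_mat_simps)
qed

lemma representation_mult:
  assumes "representation G d \<rho>" "g \<in> carrier G" "h \<in> carrier G"
  shows "\<rho> (g \<otimes>\<^bsub>G\<^esub> h) = \<rho> g * \<rho> h"
  using hom_mult[OF assms(1)[unfolded representation_def] assms(2,3)]
  by (simp add: units_of_mult ring_mat_simps)

lemma representation_one:
  assumes "group G" "representation G d \<rho>"
  shows "\<rho> \<one>\<^bsub>G\<^esub> = 1\<^sub>m d"
proof -
  interpret M: ring "ring_mat TYPE(complex) d ()" by (rule ring_mat)
  have "\<rho> \<one>\<^bsub>G\<^esub> = \<one>\<^bsub>GL d\<^esub>"
    using hom_one[of \<rho> G "GL d"] assms M.units_group by (simp add: representation_def)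
  then show ?thesis
    by (simp add: units_of_one ring_mat_simps)
qed

text \<open>Invertibility is automatic: \<open>\<rho> (inv g)\<close> is a two-sided inverse of
  \<open>\<rho> g\<close>.\<close>

lemma representationI:
  assumes "group G"
    and mat: "\<And>g. g \<in> carrier G \<Longrightarrow> \<rho> g \<in> carrier_mat d d"
    and mult: "\<And>g h. g \<in> carrier G \<Longrightarrow> h \<in> carrier G \<Longrightarrow> \<rho> (g \<otimes>\<^bsub>G\<^esub> h) = \<rho> g * \<rho> h"
    and one: "\<rho> \<one>\<^bsub>G\<^esub> = 1\<^sub>m d"
  shows "representation G d \<rho>"
proof -
  interpret group G by fact
  have "\<rho> g \<in> Units (ring_mat TYPE(complex) d ())" if g: "g \<in> carrier G" for g
  proof -
    have "\<rho> g * \<rho> (inv\<^bsub>G\<^esub> g) = 1\<^sub>m d" "\<rho> (inv\<^bsub>G\<^esub> g) * \<rho> g = 1\<^sub>m d"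
      using g by (simp_all flip: mult add: one)
    then show ?thesis
      unfolding Units_def using mat[OF g] mat[of "inv\<^bsub>G\<^esub> g"] g by (auto simp: ring_mat_simps)
  qed
  then show ?thesis
    by (auto simp: representation_def hom_def units_of_carrier units_of_mult ring_mat_simps mult)
qed

section \<open>Invariant subspaces and Schur's lemma\<close>

lemma subspace_module_vecI:
  fixes W :: "'a::field vec set"
  assumes "W \<subseteq> carrier_vec d" "0\<^sub>v d \<in> W"
    and "\<And>v w. v \<in> W \<Longrightarrow> w \<in> W \<Longrightarrow> v + w \<in> W"
    and "\<And>c v. v \<in> W \<Longrightarrow> c \<cdot>\<^sub>v v \<in> W"
  shows "VectorSpace.subspace class_ring W (module_vec TYPE('a) d)"
proof -
  interpret vec_space "TYPE('a)" d .
  show ?thesis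
    unfolding VectorSpace.subspace_def submodule_def
    using vectorspace_axioms module_axioms assms by (auto simp: module_vec_simps)
qed

lemma subspace_module_vecD:
  fixes W :: "'a::field vec set"
  assumes "VectorSpace.subspace class_ring W (module_vec TYPE('a) d)"
  shows "W \<subseteq> carrier_vec d" "0\<^sub>v d \<in> W"
    and "\<And>v w. v \<in> W \<Longrightarrow> w \<in> W \<Longrightarrow> v + w \<in> W"
    and "\<And>c v. v \<in> W \<Longrightarrow> c \<cdot>\<^sub>v v \<in> W"
  using assms unfolding VectorSpace.subspace_def submodule_def by (auto simp: module_vec_simps)

lemma irreducible_representation_subspace_eq:
  assumes irr: "irreducible_representation G d \<rho>"
    and sub: "VectorSpace.subspace class_ring W (module_vec TYPE(complex) d)"
    and inv: "\<And>g w. g \<in> carrier G \<Longrightarrow> w \<in> W \<Longrightarrow> \<rho> g *\<^sub>v w \<in> W"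
    and v: "v \<in> W" "v \<noteq> 0\<^sub>v d"
  shows "W = carrier_vec d"
  using assms unfolding irreducible_representation_def invariant_subspace_def by blast

text \<open>The span of \<open>S\<close> is invariant, since each \<open>\<rho> g\<close> sends
  members of \<open>S\<close> to multiples of members of \<open>S\<close>. By irreducibility it is
  the whole space, and a spanning set has at least \<open>d\<close> elements.\<close>

lemma irreducible_representation_dim_le:
  assumes irr: "irreducible_representation G d \<rho>"
    and S: "finite S" "S \<subseteq> carrier_vec d" "v \<in> S" "v \<noteq> 0\<^sub>v d"
    and inv: "\<And>g s. g \<in> carrier G \<Longrightarrow> s \<in> S \<Longrightarrow> \<exists>c. \<exists>s'\<in>S. \<rho> g *\<^sub>v s = c \<cdot>\<^sub>v s'"
  shows "d \<le> card S"
proof -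
  interpret V: vec_space "TYPE(complex)" d .
  let ?W = "V.span S"
  have sub: "VectorSpace.subspace class_ring ?W V.V"
    using S by (intro V.span_is_subspace) (auto simp: module_vec_simps)
  note W = subspace_module_vecD[OF sub]
  have SW: "S \<subseteq> ?W"
    using S by (intro V.in_own_span) (auto simp: module_vec_simps)
  have "\<rho> g *\<^sub>v w \<in> ?W" if g: "g \<in> carrier G" and w: "w \<in> ?W" for g w
  proof -
    have mat: "\<rho> g \<in> carrier_mat d d"
      using irr g representation_carrier_mat by (auto simp: irreducible_representation_def)
    have zero: "\<rho> g *\<^sub>v 0\<^sub>v d = 0\<^sub>v d"
      using mat by (intro eq_vecI) auto
    \<comment> \<open>The part of the preimage of \<open>?W\<close> under \<open>\<rho> g\<close> in
      the space: a subspace that contains \<open>S\<close>, hence the span of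
      \<open>S\<close>.\<close>
    let ?U = "{w \<in> carrier_vec d. \<rho> g *\<^sub>v w \<in> ?W}"
    have "VectorSpace.subspace class_ring ?U V.V"
      using mat W zero by (intro subspace_module_vecI)
        (auto simp: mult_add_distrib_mat_vec[of _ d d] mult_mat_vec[of _ d d])
    moreover have "S \<subseteq> ?U"
    proof
      fix s assume s: "s \<in> S"
      with inv[OF g] obtain c s' where "s' \<in> S" "\<rho> g *\<^sub>v s = c \<cdot>\<^sub>v s'" by blast
      with W(4)[of s' c] SW S(2) s show "s \<in> ?U" by auto
    qed
    ultimately have "?W \<subseteq> ?U"
      by (intro V.span_is_subset) (auto simp: VectorSpace.subspace_def)
    with w show ?thesis by auto
  qed
  with irr sub SW S have "?W = carrier_vec d"
    by (intro irreducible_representation_subspace_eq[where v = v]) auto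
  then have "V.dim \<le> card S"
    using S by (intro V.gen_ge_dim) (auto simp: module_vec_simps)
  then show ?thesis by (simp add: V.dim_is_n)
qed

lemma mat_eq_smult_oneI:
  fixes A :: "'a::comm_ring_1 mat"
  assumes A: "A \<in> carrier_mat d d" and eq: "\<And>w. w \<in> carrier_vec d \<Longrightarrow> A *\<^sub>v w = c \<cdot>\<^sub>v w"
  shows "A = c \<cdot>\<^sub>m 1\<^sub>m d"
proof (rule eq_matI)
  fix i j assume "i < dim_row (c \<cdot>\<^sub>m 1\<^sub>m d)" "j < dim_col (c \<cdot>\<^sub>m 1\<^sub>m d)"
  then have ij: "i < d" "j < d" by auto
  have "A $$ (i, j) = (A *\<^sub>v unit_vec d j) $ i"
    using A ij by (simp add: row_def scalar_prod_right_unit)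
  also have "\<dots> = (c \<cdot>\<^sub>v unit_vec d j) $ i"
    using eq[of "unit_vec d j"] by simp
  finally show "A $$ (i, j) = (c \<cdot>\<^sub>m 1\<^sub>m d) $$ (i, j)"
    using ij by (simp add: unit_vec_def)
qed (use A in auto)

text \<open>The eigenspace of \<open>A\<close> for \<open>c\<close> is invariant because
  \<open>A\<close> commutes with the representation, and nonzero because of \<open>v\<close>;
  irreducibility makes it the whole space.\<close>

lemma schur_scalar:
  assumes irr: "irreducible_representation G d \<rho>"
    and A: "A \<in> carrier_mat d d"
    and comm: "\<And>g. g \<in> carrier G \<Longrightarrow> A * \<rho> g = \<rho> g * A"
    and v: "v \<in> carrier_vec d" "v \<noteq> 0\<^sub>v d" "A *\<^sub>v v = c \<cdot>\<^sub>v v"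
  shows "A = c \<cdot>\<^sub>m 1\<^sub>m d"
proof -
  let ?W = "{w \<in> carrier_vec d. A *\<^sub>v w = c \<cdot>\<^sub>v w}"
  have sub: "VectorSpace.subspace class_ring ?W (module_vec TYPE(complex) d)"
    using A by (intro subspace_module_vecI)
      (auto simp: mult_add_distrib_mat_vec[of _ d d] mult_mat_vec[of _ d d]
        smult_add_distrib_vec[of _ d] smult_smult_assoc mult.commute)
  have inv: "\<rho> g *\<^sub>v w \<in> ?W" if g: "g \<in> carrier G" and w: "w \<in> ?W" for g w
  proof -
    have mat: "\<rho> g \<in> carrier_mat d d"
      using irr g representation_carrier_mat by (auto simp: irreducible_representation_def)
    have "A *\<^sub>v (\<rho> g *\<^sub>v w) = (A * \<rho> g) *\<^sub>v w"
      using A mat w by simp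
    also have "\<dots> = \<rho> g *\<^sub>v (A *\<^sub>v w)"
      using A mat w by (simp add: comm[OF g])
    also have "\<dots> = c \<cdot>\<^sub>v (\<rho> g *\<^sub>v w)"
      using mat w by (simp add: mult_mat_vec)
    finally show ?thesis using mat w by auto
  qed
  have "?W = carrier_vec d"
    by (rule irreducible_representation_subspace_eq[OF irr sub inv, where v = v]) (use v in auto)
  with A show ?thesis by (intro mat_eq_smult_oneI) auto
qed

lemma mat_trace_add:
  assumes "A \<in> carrier_mat d d" "B \<in> carrier_mat d d"
  shows "mat_trace (A + B) = mat_trace A + mat_trace B"
  using assms by (simp add: mat_trace_def sum.distrib)

lemma mat_trace_smult:
  fixes A :: "'a::comm_semiring_0 mat"
  assumes "A \<in> carrier_mat d d"
  shows "mat_trace (c \<cdot>\<^sub>m A) = c * mat_trace A"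
  using assms by (simp add: mat_trace_def sum_distrib_left)

lemma mat_trace_one: "mat_trace (1\<^sub>m d :: 'a::semiring_1 mat) = of_nat d"
  by (simp add: mat_trace_def)

text \<open>The line through \<open>v\<close> is invariant, so \<open>d = 1\<close>, and the trace
  is the single entry of \<open>\<rho> g\<close>.\<close>

lemma mat_trace_irreducible_common_eigenvector:
  assumes irr: "irreducible_representation G d \<rho>"
    and v: "v \<in> carrier_vec d" "v \<noteq> 0\<^sub>v d"
    and eig: "\<And>g. g \<in> carrier G \<Longrightarrow> \<rho> g *\<^sub>v v = f g \<cdot>\<^sub>v v"
    and g: "g \<in> carrier G"
  shows "mat_trace (\<rho> g) = f g"
proof -
  have "d \<le> card {v}"
    by (rule irreducible_representation_dim_le[OF irr, of _ v]) (use v eig in auto)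
  with irr have d: "d = 1" by (auto simp: irreducible_representation_def)
  have mat: "\<rho> g \<in> carrier_mat 1 1"
    using irr g representation_carrier_mat d by (auto simp: irreducible_representation_def)
  from v d have nz: "v $ 0 \<noteq> 0" by (metis eq_vecI index_zero_vec carrier_vecD less_one)
  have "(\<rho> g *\<^sub>v v) $ 0 = (f g \<cdot>\<^sub>v v) $ 0" using eig[OF g] by simp
  then have "\<rho> g $$ (0, 0) * v $ 0 = f g * v $ 0"
    using mat v d by (simp add: scalar_prod_def)
  with nz mat show ?thesis by (simp add: mat_trace_def)
qed

lemma irreducible_representation_dim_one:
  assumes "representation G 1 \<rho>"
  shows "irreducible_representation G 1 \<rho>"
proof -
  have "W = carrier_vec 1" if inv: "invariant_subspace G 1 \<rho> W" and W: "W \<noteq> {0\<^sub>v 1}" for W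
  proof -
    have sub: "VectorSpace.subspace class_ring W (module_vec TYPE(complex) 1)"
      using inv by (simp add: invariant_subspace_def)
    note W' = subspace_module_vecD[OF sub]
    obtain w where w: "w \<in> W" "w \<noteq> 0\<^sub>v 1" using W W'(2) by blast
    have nz: "w $ 0 \<noteq> 0"
    proof
      assume "w $ 0 = 0"
      then have "w = 0\<^sub>v 1" using w(1) W'(1) by (intro eq_vecI) auto
      with w(2) show False by simp
    qed
    have "v \<in> W" if "v \<in> carrier_vec 1" for v
    proof -
      have "v = (v $ 0 / w $ 0) \<cdot>\<^sub>v w"
        using that w(1) W'(1) nz by (intro eq_vecI) auto
      then show ?thesis using W'(4)[OF w(1)] by metis
    qed
    with W'(1) show ?thesis by blast
  qed
  with assms show ?thesis by (auto simp: irreducible_representation_def)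
qed

section \<open>Passage from conjugacy classes to group elements\<close>

lemma (in group) AM_Z_eq_sum_carrier:
  assumes fin: "finite (carrier G)"
  shows "AM_Z G = 1 / (real (Coset.order G))\<^sup>2 *
    (\<Sum>x\<in>carrier G. \<Sum>y\<in>carrier G. cmod (\<Sum>\<chi>\<in>Irr G. (\<chi> \<one>)\<^sup>2 * \<chi> x * cnj (\<chi> y)))"
proof -
  interpret act: group_action G "carrier G" "\<lambda>h. \<lambda>g\<in>carrier G. h \<otimes> g \<otimes> inv h"
    by (rule action_by_conjugation)
  \<comment> \<open>Conjugacy classes are the orbits of conjugation, so they partition the
    carrier.\<close>
  have sum_Conj: "(\<Sum>x\<in>carrier G. f x) = (\<Sum>C\<in>Conj G. \<Sum>x\<in>C. f x)" for f :: "'a \<Rightarrow> real"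
    unfolding Conj_def by (rule act.disjoint_sum[OF fin, symmetric])
  let ?f = "\<lambda>x y. cmod (\<Sum>\<chi>\<in>Irr G. (\<chi> \<one>)\<^sup>2 * \<chi> x * cnj (\<chi> y))"
  let ?F = "\<lambda>C D. cmod (\<Sum>\<chi>\<in>Irr G. (char_degree G \<chi>)\<^sup>2 * class_value \<chi> C * cnj (class_value \<chi> D))"
  have val: "class_value \<chi> C = \<chi> x" if "\<chi> \<in> Irr G" "C \<in> Conj G" "x \<in> C" for \<chi> C x
    using that by (auto simp: Irr_def irreducible_representation_def class_value_char_of_rep[OF is_group])
  have fF: "?f x y = ?F C D" if CD: "C \<in> Conj G" "x \<in> C" "D \<in> Conj G" "y \<in> D" for C D x y
  proof -
    have "(\<chi> \<one>)\<^sup>2 * \<chi> x * cnj (\<chi> y) =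
        (char_degree G \<chi>)\<^sup>2 * class_value \<chi> C * cnj (class_value \<chi> D)" if "\<chi> \<in> Irr G" for \<chi>
      by (simp only: char_degree_def val[OF that CD(1,2)] val[OF that CD(3,4)])
    then show ?thesis by simp
  qed
  have "(\<Sum>x\<in>carrier G. \<Sum>y\<in>carrier G. ?f x y) = (\<Sum>C\<in>Conj G. \<Sum>x\<in>C. \<Sum>D\<in>Conj G. \<Sum>y\<in>D. ?f x y)"
    by (simp only: sum_Conj)
  also have "\<dots> = (\<Sum>C\<in>Conj G. \<Sum>x\<in>C. \<Sum>D\<in>Conj G. \<Sum>y\<in>D. ?F C D)"
    by (intro sum.cong HOL.refl fF)
  \<comment> \<open>The summand no longer depends on \<open>x\<close> and \<open>y\<close>, so the
    sums over \<open>C\<close> and \<open>D\<close> become the factors \<open>card C\<close> and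
    \<open>card D\<close>.\<close>
  also have "\<dots> = (\<Sum>C\<in>Conj G. \<Sum>D\<in>Conj G. ?F C D * real (card C) * real (card D))"
    by (simp add: sum_distrib_left mult_ac)
  finally show ?thesis by (simp add: AM_Z_def)
qed

section \<open>Roots of unity\<close>

text \<open>This makes characters and matrices built from powers of \<open>z\<close> well defined on
  group elements, whose rotation exponent is known only modulo \<open>n\<close>.\<close>

lemma power_int_mod_root_of_unity:
  fixes z :: "'a::field"
  assumes "z ^ n = 1" "n > 0"
  shows "z powi (k mod int n) = z powi k"
proof -
  have z: "z \<noteq> 0" using assms by (auto simp: power_0_left)
  have "z powi k = z powi (int n * (k div int n) + k mod int n)" by simp
  also have "\<dots> = (z powi int n) powi (k div int n) * z powi (k mod int n)"
    by (simp only: power_int_add[OF disjI1[OF z]] power_int_mult)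
  finally show ?thesis using assms by simp
qed

lemma power_int_minus_square_one:
  fixes z :: "'a::field"
  assumes "z\<^sup>2 = 1"
  shows "z powi (- k) = z powi k"
proof -
  have "z = 1 \<or> z = - 1" using assms by (simp add: power2_eq_1_iff)
  then show ?thesis by (auto simp: power_int_minus simp flip: power_int_inverse)
qed

text \<open>Unless \<open>n\<close> divides \<open>k\<close>, multiplication by a primitive root
  \<open>\<zeta>\<close> permutes the roots of unity and scales the sum by
  \<open>\<zeta> powi k\<close>, which is not 1; so the sum vanishes.\<close>

lemma sum_powi_roots_of_unity:
  assumes "n > 0"
  shows "(\<Sum>z | z ^ n = 1. z powi k) = (if int n dvd k then of_nat n else 0 :: complex)"
proof (cases "int n dvd k")
  case True
  then obtain j where "k = int n * j" by blast
  then have "z powi k = 1" if "z ^ n = 1" for z :: complex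
    using that by (simp add: power_int_mult)
  with True show ?thesis using card_roots_unity_eq[OF assms] by simp
next
  case False
  define \<zeta> where "\<zeta> = cis (2 * pi / real n)"
  have \<zeta>_pow: "\<zeta> ^ j = cis (2 * pi * real j / real n)" for j
    by (simp add: \<zeta>_def DeMoivre mult_ac)
  have \<zeta>n: "\<zeta> ^ n = 1" using assms by (simp add: \<zeta>_pow)
  then have \<zeta>0: "\<zeta> \<noteq> 0" using assms by (auto simp: power_0_left)
  have "\<zeta> powi k \<noteq> 1"
  proof
    assume 1: "\<zeta> powi k = 1"
    define j where "j = nat (k mod int n)"
    have j: "j < n" "int j = k mod int n" using assms by (simp_all add: j_def nat_less_iff)
    \<comment> \<open>With the exponent reduced below \<open>n\<close>, injectivity of the
      enumeration of the roots of unity applies.\<close>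
    have "\<zeta> ^ j = \<zeta> ^ 0"
      using 1 power_int_mod_root_of_unity[OF \<zeta>n assms, of k] by (simp flip: j(2))
    then have "j = 0"
      using inj_onD[OF bij_betw_imp_inj_on[OF bij_betw_roots_unity[OF assms]], of j 0] j(1) assms
      by (simp add: \<zeta>_pow)
    with j(2) False show False by (simp add: dvd_eq_mod_eq_0)
  qed
  moreover have "(\<Sum>z | z ^ n = 1. z powi k) = \<zeta> powi k * (\<Sum>z | z ^ n = 1. z powi k)"
  proof -
    have "(\<Sum>z | z ^ n = 1. z powi k) = (\<Sum>z | z ^ n = 1. (\<zeta> * z) powi k)"
      by (rule sum.reindex_bij_witness[where i = "\<lambda>z. \<zeta> * z" and j = "\<lambda>z. z / \<zeta>"])
        (use \<zeta>0 \<zeta>n in \<open>auto simp: power_mult_distrib power_divide\<close>)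
    also have "\<dots> = \<zeta> powi k * (\<Sum>z | z ^ n = 1. z powi k)"
      by (simp only: power_int_mult_distrib sum_distrib_left)
    finally show ?thesis .
  qed
  ultimately show ?thesis using False by simp
qed

lemma cnj_root_of_unity:
  assumes "z ^ n = 1" "n > 0"
  shows "cnj z = inverse z"
proof -
  have "norm z = 1" using power_eq_1_iff[OF assms(1)] assms(2) by simp
  then have "z * cnj z = 1" using complex_norm_square[of z] by simp
  then show ?thesis by (metis inverse_unique)
qed

text \<open>One condition in place of two, so that \<open>sum_powi_roots_of_unity\<close> also
  evaluates the sum over the linear characters.\<close>

lemma square_one_roots_of_unity:
  "{\<alpha>::complex. \<alpha> ^ n = 1 \<and> \<alpha>\<^sup>2 = 1} = {\<alpha>. \<alpha> ^ gcd n 2 = 1}"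
  by (cases "even n") (auto simp: power2_eq_1_iff)

section \<open>Summation of the absolute values\<close>

text \<open>Among any \<open>m\<close> consecutive \<open>l\<close> exactly one is counted, with
  weight \<open>m\<close>, and \<open>m\<close> divides \<open>n\<close>.\<close>

lemma gcd_2_sum_congruent:
  fixes n :: nat and k :: int
  defines "m \<equiv> gcd n 2"
  shows "(\<Sum>l<n. if int m dvd k + int l then int m else 0) = int n"
proof (cases "even n")
  case True
  then obtain p where p: "n = 2 * p" by blast
  have "(\<Sum>l<2 * p. if 2 dvd k + int l then 2 else 0) = 2 * int p"
    by (induction p) auto
  moreover have "m = 2" using p by (simp add: m_def)
  ultimately show ?thesis using p by (simp cong: if_cong)
next
  case False
  then have "m = 1" by (simp add: m_def)
  then show ?thesis by simp
qed

text \<open>This counts the rotations \<open>r^k\<close> that are their own inverse.\<close>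

lemma card_dvd_double:
  assumes "n > 0"
  shows "card {k. k < n \<and> n dvd 2 * k} = gcd n 2"
proof (cases "even n")
  case True
  then obtain p where p: "n = 2 * p" by blast
  then have "{k. k < n \<and> n dvd 2 * k} = {0, p}"
    using assms by (auto elim!: dvdE)
  with p assms show ?thesis by simp
next
  case False
  then have "n dvd 2 * k \<longleftrightarrow> n dvd k" for k
    by (simp add: coprime_dvd_mult_right_iff)
  then have "{k. k < n \<and> n dvd 2 * k} = {0}"
    using assms by (auto dest: dvd_imp_le)
  with False show ?thesis by simp
qed

lemma sum_of_bool_dvd_add:
  fixes k :: int
  assumes "n > 0"
  shows "(\<Sum>l<n. of_bool (int n dvd k + int l)) = (1 :: int)"
proof -
  \<comment> \<open>The residue of \<open>- k\<close> is the only \<open>l < n\<close> for which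
    \<open>n\<close> divides \<open>k + l\<close>.\<close>
  define j where "j = nat ((- k) mod int n)"
  have j: "j < n" "int j = (- k) mod int n" using assms by (simp_all add: j_def nat_less_iff)
  have "int n dvd k + int l \<longleftrightarrow> l = j" if "l < n" for l
  proof -
    have "int n dvd k + int l \<longleftrightarrow> int l mod int n = (- k) mod int n"
      by (simp add: mod_eq_dvd_iff add.commute)
    also have "\<dots> \<longleftrightarrow> l = j" using that j by auto
    finally show ?thesis .
  qed
  then have "(\<Sum>l<n. of_bool (int n dvd k + int l)) = (\<Sum>l<n. of_bool (l = j) :: int)"
    by (intro sum.cong) auto
  also have "\<dots> = 1" using j by (simp add: of_bool_def)
  finally show ?thesis .
qed

lemma int_dvd_diff_iff_eq:
  assumes "k < n" "l < n"
  shows "int n dvd int k - int l \<longleftrightarrow> l = k"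
  using assms by (auto simp flip: mod_eq_dvd_iff)

text \<open>Once the absolute values are resolved, the summand is a linear combination of
  \<open>A + B\<close>, \<open>A * B\<close> and \<open>E\<close>, whose double sums are
  \<open>2n\<close>, \<open>m\<close> and \<open>n^2\<close>.\<close>

lemma sum_abs_dihedral:
  fixes n :: nat
  assumes "n \<ge> 3"
  defines "m \<equiv> gcd n 2"
  defines "E \<equiv> \<lambda>k l. if int m dvd int k + int l then int m else 0"
  defines "A \<equiv> \<lambda>k l. of_bool (int n dvd int k + int l) :: int"
    and "B \<equiv> \<lambda>k l. of_bool (int n dvd int k - int l) :: int"
  shows "(\<Sum>k<n. \<Sum>l<n. \<bar>4 * int n * (A k l + B k l) - 6 * E k l\<bar> + \<bar>2 * E k l\<bar>) =
    16 * (int n)\<^sup>2 - 24 * int m * int n + 12 * (int m)\<^sup>2"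
proof -
  have n: "n > 0" using assms(1) by simp
  have mn: "m dvd n" and m2: "m dvd 2" by (auto simp: m_def)
  \<comment> \<open>Where \<open>A\<close> or \<open>B\<close> is 1, \<open>E\<close> equals
    \<open>m\<close>, so this bound makes the argument of the first absolute value nonnegative
    there. It fails for \<open>n = 1\<close> and \<open>n = 2\<close>.\<close>
  have m_le: "4 * int n \<ge> 6 * int m"
  proof (cases "even n")
    case True
    then have "n \<ge> 4" "m = 2" using assms(1) by (auto simp: m_def elim!: evenE)
    then show ?thesis by simp
  next
    case False
    then show ?thesis using assms(1) by (simp add: m_def)
  qed
  \<comment> \<open>As \<open>k + l\<close> and \<open>k - l\<close> differ by \<open>2 * l\<close>
    and \<open>m\<close> divides 2, divisibility of either one by \<open>n\<close> gives
    divisibility of \<open>k + l\<close> by \<open>m\<close>.\<close>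
  have E_m: "E k l = int m" if "int n dvd int k + int l \<or> int n dvd int k - int l" for k l
  proof -
    have "int m dvd int k + int l"
      using that
    proof
      assume "int n dvd int k - int l"
      then have "int m dvd int k - int l" using mn by (meson dvd_trans int_dvd_int_iff)
      moreover have "int m dvd 2 * int l" using m2 by (metis dvd_mult2 int_dvd_int_iff of_nat_numeral)
      ultimately have "int m dvd (int k - int l) + 2 * int l" by (rule dvd_add)
      then show ?thesis by (simp add: algebra_simps)
    qed (use mn in \<open>meson dvd_trans int_dvd_int_iff\<close>)
    then show ?thesis by (simp add: E_def)
  qed
  \<comment> \<open>The first absolute value changes its sign exactly where \<open>A k l = B k l = 0\<close>;
    \<open>A + B - A * B\<close> is the indicator of the complement.\<close>
  have "\<bar>4 * int n * (A k l + B k l) - 6 * E k l\<bar> + \<bar>2 * E k l\<bar> =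
      (4 * int n - 12 * int m) * (A k l + B k l) + 12 * int m * (A k l * B k l) + 8 * E k l" for k l
  proof (cases "int n dvd int k + int l \<or> int n dvd int k - int l")
    case True
    then show ?thesis
      using m_le E_m[OF True] n
      by (cases "int n dvd int k + int l"; cases "int n dvd int k - int l")
        (simp_all add: A_def B_def)
  next
    case False
    then show ?thesis by (simp add: A_def B_def E_def)
  qed
  then have "(\<Sum>k<n. \<Sum>l<n. \<bar>4 * int n * (A k l + B k l) - 6 * E k l\<bar> + \<bar>2 * E k l\<bar>) =
      (4 * int n - 12 * int m) * ((\<Sum>k<n. \<Sum>l<n. A k l) + (\<Sum>k<n. \<Sum>l<n. B k l))
      + 12 * int m * (\<Sum>k<n. \<Sum>l<n. A k l * B k l) + 8 * (\<Sum>k<n. \<Sum>l<n. E k l)"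
    by (simp add: sum.distrib sum_distrib_left distrib_left)
  moreover have "(\<Sum>k<n. \<Sum>l<n. A k l) = int n"
    unfolding A_def using sum_of_bool_dvd_add[OF n] by simp
  moreover have "(\<Sum>k<n. \<Sum>l<n. E k l) = (int n)\<^sup>2"
    unfolding E_def m_def using gcd_2_sum_congruent[where n = n] by (simp add: power2_eq_square)
  moreover have B: "B k l = of_bool (l = k)" if "k < n" "l < n" for k l
    using int_dvd_diff_iff_eq[OF that] by (simp add: B_def)
  have "(\<Sum>k<n. \<Sum>l<n. B k l) = (\<Sum>k<n. \<Sum>l<n. of_bool (l = k))"
    using B by (intro sum.cong) auto
  then have "(\<Sum>k<n. \<Sum>l<n. B k l) = int n"
    by (simp add: of_bool_def)
  moreover have "(\<Sum>k<n. \<Sum>l<n. A k l * B k l) = int m"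
  proof -
    \<comment> \<open>For indices below \<open>n\<close>, \<open>B\<close> selects the diagonal,
      which leaves the number of \<open>k\<close> with \<open>n\<close> dividing
      \<open>2 * k\<close>.\<close>
    have "(\<Sum>k<n. \<Sum>l<n. A k l * B k l) = (\<Sum>k<n. \<Sum>l<n. if l = k then A k k else 0)"
      using B by (intro sum.cong) auto
    also have "\<dots> = (\<Sum>k<n. A k k)" by simp
    also have "\<dots> = (\<Sum>k<n. of_bool (n dvd 2 * k))"
      by (simp add: A_def flip: of_nat_add mult_2)
    also have "\<dots> = int (card {k. k < n \<and> n dvd 2 * k})"
      by (simp add: of_bool_def sum.If_cases Int_def lessThan_def)
    also have "\<dots> = int m"
      by (simp add: card_dvd_double[OF n] m_def)
    finally show ?thesis .
  qed
  ultimately show ?thesis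
    by (simp add: power2_eq_square algebra_simps)
qed

section \<open>Abstract dihedral groups\<close>

text \<open>The relations together with a unique normal form \<open>r^k t^b\<close>. The
  representation theory below rests on these alone; words reappear only when the presented group is
  shown to be an instance.\<close>

locale dihedral = group G for G (structure) +
  fixes n :: nat and r t
  assumes n_pos: "n > 0"
    and r_closed [simp]: "r \<in> carrier G" and t_closed [simp]: "t \<in> carrier G"
    and r_pow: "r [^] n = \<one>" and t_sq: "t \<otimes> t = \<one>" and t_r: "t \<otimes> r = inv r \<otimes> t"
    and normal_form: "bij_betw (\<lambda>(k, b). r [^] (k::nat) \<otimes> (if b then t else \<one>))
      ({..<n} \<times> UNIV) (carrier G)"
begin

text \<open>The exponent ranges over all integers, so that products and inverses need no reduction
  modulo \<open>n\<close>.\<close>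

definition elt :: "int \<Rightarrow> bool \<Rightarrow> 'a" where
  "elt k b = r [^] k \<otimes> (if b then t else \<one>)"

lemma elt_closed [simp]: "elt k b \<in> carrier G"
  by (simp add: elt_def)

lemma r_int_pow_mod: "r [^] (k mod int n) = r [^] (k::int)"
proof -
  have "r [^] k = r [^] (int n * (k div int n) + k mod int n)" by simp
  also have "\<dots> = (r [^] int n) [^] (k div int n) \<otimes> r [^] (k mod int n)"
    by (simp only: int_pow_mult int_pow_pow r_closed)
  finally show ?thesis by (simp add: int_pow_int r_pow)
qed

lemma r_int_pow_cong: "k mod int n = l mod int n \<Longrightarrow> r [^] (k::int) = r [^] (l::int)"
  by (metis r_int_pow_mod)

lemma elt_cong:
  assumes "k mod int n = l mod int n"
  shows "elt k b = elt l b"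
  using r_int_pow_cong[OF assms] by (simp add: elt_def)

text \<open>Induction settles natural exponents; an integer exponent can be replaced by its residue
  modulo \<open>n\<close>.\<close>

lemma t_r_pow: "t \<otimes> r [^] (k::int) = r [^] (- k) \<otimes> t"
proof -
  have nat: "t \<otimes> r [^] m = inv (r [^] m) \<otimes> t" for m :: nat
  proof (induction m)
    case (Suc m)
    have "t \<otimes> r [^] Suc m = (t \<otimes> r [^] m) \<otimes> r" by (simp add: m_assoc)
    also have "\<dots> = inv (r [^] m) \<otimes> (t \<otimes> r)" by (simp add: Suc m_assoc)
    also have "\<dots> = inv (r \<otimes> r [^] m) \<otimes> t" by (simp add: t_r m_assoc inv_mult_group)
    finally show ?case by (simp only: nat_pow_Suc2 r_closed)
  qed simp
  define m where "m = nat (k mod int n)"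
  have m: "r [^] k = r [^] m"
    using n_pos by (simp add: m_def r_int_pow_mod flip: int_pow_int)
  then show ?thesis using nat[of m] by (simp add: int_pow_neg)
qed

text \<open>The semidirect product law: \<open>t\<close> inverts each rotation it is moved past, and
  \<open>b \<noteq> c\<close> is addition modulo 2.\<close>

lemma elt_mult: "elt k b \<otimes> elt l c = elt (k + (if b then - l else l)) (b \<noteq> c)"
proof -
  have "r [^] k \<otimes> t \<otimes> (r [^] l \<otimes> x) = r [^] (k - l) \<otimes> (t \<otimes> x)" if "x \<in> carrier G" for x
  proof -
    have "r [^] k \<otimes> t \<otimes> (r [^] l \<otimes> x) = r [^] k \<otimes> (t \<otimes> r [^] l) \<otimes> x"
      using that by (simp add: m_assoc)
    also have "\<dots> = (r [^] k \<otimes> r [^] (- l)) \<otimes> (t \<otimes> x)"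
      using that by (simp add: t_r_pow m_assoc)
    finally show ?thesis by (simp flip: int_pow_mult)
  qed
  from this[of t] this[of \<one>] show ?thesis
    by (cases b; cases c) (simp_all add: elt_def t_sq int_pow_mult m_assoc)
qed

lemma elt_one: "elt 0 False = \<one>"
  by (simp add: elt_def)

lemma bij_betw_elt: "bij_betw (\<lambda>(k, b). elt (int k) b) ({..<n} \<times> UNIV) (carrier G)"
  using normal_form by (simp add: elt_def int_pow_int)

lemma eltE:
  assumes "g \<in> carrier G"
  obtains k b where "g = elt k b"
  using assms bij_betw_imp_surj_on[OF bij_betw_elt] by force

lemma finite_carrier: "finite (carrier G)"
  using bij_betw_finite[OF bij_betw_elt] by simp

lemma order_eq: "Coset.order G = 2 * n"
  using bij_betw_same_card[OF bij_betw_elt] by (simp add: Coset.order_def card_cartesian_product)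

lemma elt_eq_iff: "elt k b = elt l c \<longleftrightarrow> k mod int n = l mod int n \<and> b = c"
proof
  assume eq: "elt k b = elt l c"
  define k' l' where "k' = nat (k mod int n)" and "l' = nat (l mod int n)"
  have k': "k' < n" "int k' = k mod int n" and l': "l' < n" "int l' = l mod int n"
    using n_pos by (simp_all add: k'_def l'_def nat_less_iff)
  have "elt (int k') b = elt (int l') c"
    using eq by (metis elt_cong k'(2) l'(2) mod_mod_trivial)
  with bij_betw_imp_inj_on[OF bij_betw_elt] k'(1) l'(1) have "(k', b) = (l', c)"
    by (auto dest!: inj_onD[where x = "(k', b)" and y = "(l', c)"])
  with k' l' show "k mod int n = l mod int n \<and> b = c" by auto
qed (auto intro: elt_cong)

text \<open>A function of the coordinates \<open>(k, b)\<close> of \<open>elt k b\<close>; it is well defined when \<open>f\<close>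
  depends on \<open>k\<close> only modulo \<open>n\<close>.\<close>

definition lift :: "(int \<Rightarrow> bool \<Rightarrow> 'c) \<Rightarrow> 'a \<Rightarrow> 'c" where
  "lift f g = (case SOME p. g = elt (fst p) (snd p) of (k, b) \<Rightarrow> f k b)"

text \<open>By \<open>elt_eq_iff\<close>, the chosen coordinates differ from \<open>(k, b)\<close>
  at most by a multiple of \<open>n\<close> in the exponent.\<close>

lemma lift_elt:
  assumes "\<And>k b. f (k mod int n) b = f k b"
  shows "lift f (elt k b) = f k b"
proof -
  define p where "p = (SOME p. elt k b = elt (fst p) (snd p))"
  have "elt k b = elt (fst p) (snd p)"
    unfolding p_def by (rule someI[of _ "(k, b)"]) simp
  then have "fst p mod int n = k mod int n" "snd p = b" by (auto simp: elt_eq_iff)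
  then have "f (fst p) (snd p) = f k b" using assms[of "fst p" b] assms[of k b] by simp
  then show ?thesis by (simp add: lift_def p_def split_beta)
qed

text \<open>A family of matrices that obeys the law of \<open>elt_mult\<close> in the coordinates is
  a representation.\<close>

lemma representation_lift:
  assumes mat: "\<And>k b. M k b \<in> carrier_mat d d"
    and mult: "\<And>k b l c. M k b * M l c = M (k + (if b then - l else l)) (b \<noteq> c)"
    and one: "M 0 False = 1\<^sub>m d"
    and period: "\<And>k b. M (k mod int n) b = M k b"
  shows "representation G d (lift M)"
proof (rule representationI[OF is_group])
  show "lift M g \<in> carrier_mat d d" if g: "g \<in> carrier G" for g
  proof -
    obtain k b where "g = elt k b" using g by (rule eltE)
    then show ?thesis by (simp only: lift_elt[of M, OF period] mat)
  qed
  show "lift M (g \<otimes> h) = lift M g * lift M h" if gh: "g \<in> carrier G" "h \<in> carrier G" for g h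
  proof -
    obtain k b where "g = elt k b" using gh(1) by (rule eltE)
    moreover obtain l c where "h = elt l c" using gh(2) by (rule eltE)
    ultimately show ?thesis by (simp only: elt_mult lift_elt[of M, OF period] mult)
  qed
  show "lift M \<one> = 1\<^sub>m d"
    by (simp only: elt_one[symmetric] lift_elt[of M, OF period] one)
qed

section \<open>The characters of degree one and two\<close>

definition linear_char :: "complex \<Rightarrow> complex \<Rightarrow> 'a \<Rightarrow> complex" where
  "linear_char \<alpha> \<beta> = (\<lambda>g\<in>carrier G. lift (\<lambda>k b. \<alpha> powi k * (if b then \<beta> else 1)) g)"

definition planar_char :: "complex \<Rightarrow> 'a \<Rightarrow> complex" where
  "planar_char z = (\<lambda>g\<in>carrier G. lift (\<lambda>k b. if b then 0 else z powi k + z powi (- k)) g)"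

lemma linear_char_elt:
  assumes "\<alpha> ^ n = 1"
  shows "linear_char \<alpha> \<beta> (elt k b) = \<alpha> powi k * (if b then \<beta> else 1)"
  unfolding linear_char_def
  by (simp add: lift_elt power_int_mod_root_of_unity[OF assms n_pos])

lemma power_int_minus_mod:
  fixes z :: complex
  assumes "z ^ n = 1"
  shows "z powi (- (k mod int n)) = z powi (- k)"
  using power_int_mod_root_of_unity[OF assms n_pos, of k] by (simp add: power_int_minus)

lemma planar_char_elt:
  assumes "z ^ n = 1"
  shows "planar_char z (elt k b) = (if b then 0 else z powi k + z powi (- k))"
  unfolding planar_char_def
  by (simp add: lift_elt power_int_mod_root_of_unity[OF assms n_pos] power_int_minus_mod[OF assms])

lemma class_function_eqI:
  assumes "\<And>k b. \<chi> (elt k b) = \<psi> (elt k b)" "\<chi> \<in> extensional (carrier G)" "\<psi> \<in> extensional (carrier G)"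
  shows "\<chi> = \<psi>"
  using assms by (metis extensionalityI eltE)

text \<open>Since \<open>\<alpha>\<close> is its own inverse, the sign change of the exponent after
  a reflection does not affect its powers, so the scalars multiply correctly.\<close>

lemma linear_char_in_Irr:
  assumes \<alpha>: "\<alpha> ^ n = 1" "\<alpha>\<^sup>2 = 1" and \<beta>: "\<beta>\<^sup>2 = 1"
  shows "linear_char \<alpha> \<beta> \<in> Irr G"
proof -
  define M where "M k b = (\<alpha> powi k * (if b then \<beta> else 1)) \<cdot>\<^sub>m 1\<^sub>m 1" for k b
  have \<alpha>0: "\<alpha> \<noteq> 0" using \<alpha>(2) by auto
  have period: "M (k mod int n) b = M k b" for k b
    by (simp add: M_def power_int_mod_root_of_unity[OF \<alpha>(1) n_pos])
  have "representation G 1 (lift M)"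
  proof (rule representation_lift[of M, OF _ _ _ period])
    show "M k b * M l c = M (k + (if b then - l else l)) (b \<noteq> c)" for k b l c
      using \<alpha>0 \<beta> by (intro eq_matI)
        (auto simp: M_def scalar_prod_def power_int_add power_int_minus_square_one[OF \<alpha>(2)]
          power2_eq_square)
  qed (auto simp: M_def)
  then have "irreducible_representation G 1 (lift M)"
    by (rule irreducible_representation_dim_one)
  moreover have "linear_char \<alpha> \<beta> = char_of_rep G (lift M)"
    by (rule class_function_eqI)
      (simp_all add: linear_char_elt[OF \<alpha>(1)] char_of_rep_def lift_elt[of M, OF period],
       simp_all add: linear_char_def M_def mat_trace_def)
  ultimately show ?thesis unfolding Irr_def by blast
qed

text \<open>In the representation used, \<open>r\<close> acts diagonally with eigenvalues
  \<open>z\<close> and \<open>inverse z\<close>, and \<open>t\<close> swaps the two basis vectors.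
  The eigenvalues are distinct, so an invariant subspace that is not zero contains a basis vector,
  hence both.\<close>

lemma planar_char_in_Irr:
  assumes z: "z ^ n = 1" "z\<^sup>2 \<noteq> 1"
  shows "planar_char z \<in> Irr G"
proof -
  \<comment> \<open>The test \<open>b = (i = j)\<close> marks the vanishing entries: off the
    diagonal for rotations, on it for reflections.\<close>
  define M where "M k b = mat 2 2 (\<lambda>(i, j). if b = (i = j) then 0
    else if i = 0 then z powi k else z powi (- k))" for k b
  have z0: "z \<noteq> 0" using z(1) n_pos by (auto simp: power_0_left)
  have period: "M (k mod int n) b = M k b" for k b
    by (intro eq_matI)
      (auto simp: M_def power_int_mod_root_of_unity[OF z(1) n_pos] power_int_minus_mod[OF z(1)])
  have mat: "M k b \<in> carrier_mat 2 2" for k b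
    by (simp add: M_def)
  have rep: "representation G 2 (lift M)"
  proof (rule representation_lift[of M, OF mat _ _ period])
    show "M k b * M l c = M (k + (if b then - l else l)) (b \<noteq> c)" for k b l c
      using z0 by (intro eq_matI)
        (auto simp: M_def scalar_prod_def less_2_cases_iff numeral_2_eq_2 simp flip: power_int_add)
    show "M 0 False = 1\<^sub>m 2"
      by (intro eq_matI) (auto simp: M_def)
  qed
  have "W = carrier_vec 2" if inv: "invariant_subspace G 2 (lift M) W" and W: "W \<noteq> {0\<^sub>v 2}" for W
  proof -
    have sub: "VectorSpace.subspace class_ring W (module_vec TYPE(complex) 2)"
      using inv by (simp add: invariant_subspace_def)
    note W' = subspace_module_vecD[OF sub]
    have MW: "M k b *\<^sub>v w \<in> W" if "w \<in> W" for k b w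
      using inv that unfolding invariant_subspace_def by (metis elt_closed lift_elt period)
    have e1: "unit_vec 2 1 \<in> W" if "unit_vec 2 0 \<in> W"
    proof -
      have "M 0 True *\<^sub>v unit_vec 2 0 = unit_vec 2 1"
        by (intro eq_vecI) (auto simp: M_def less_2_cases_iff)
      with MW[OF that] show ?thesis by metis
    qed
    have e0: "unit_vec 2 0 \<in> W" if "unit_vec 2 1 \<in> W"
    proof -
      have "M 0 True *\<^sub>v unit_vec 2 1 = unit_vec 2 0"
        by (intro eq_vecI) (auto simp: M_def less_2_cases_iff)
      with MW[OF that] show ?thesis by metis
    qed
    obtain w where w: "w \<in> W" "w \<noteq> 0\<^sub>v 2" using W W'(2) by blast
    have wd: "dim_vec w = 2" using w(1) W'(1) by auto
    have e: "unit_vec 2 0 \<in> W"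
    proof (cases "w $ 0 = 0")
      case True
      have nz: "w $ 1 \<noteq> 0"
      proof
        assume "w $ 1 = 0"
        with True wd have "w = 0\<^sub>v 2" by (intro eq_vecI) (auto simp: less_2_cases_iff)
        with w(2) show False by simp
      qed
      have "unit_vec 2 1 = (1 / w $ 1) \<cdot>\<^sub>v w"
        using nz wd True by (intro eq_vecI) (auto simp: less_2_cases_iff)
      with W'(4)[OF w(1)] e0 show ?thesis by metis
    next
      case False
      have "z - inverse z \<noteq> 0"
        using z(2) z0 by (auto simp: field_simps power2_eq_square)
      with False have nz: "(z - inverse z) * w $ 0 \<noteq> 0" by simp
      \<comment> \<open>Subtracting \<open>inverse z\<close> from the action of \<open>r\<close>
        kills the second coordinate and scales the first by \<open>z - inverse z\<close>.\<close>
      have "M 1 False *\<^sub>v w + (- inverse z) \<cdot>\<^sub>v w = ((z - inverse z) * w $ 0) \<cdot>\<^sub>v unit_vec 2 0"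
        using wd by (intro eq_vecI)
          (auto simp: M_def less_Suc_eq scalar_prod_def numeral_2_eq_2 algebra_simps)
      with nz have "unit_vec 2 0 =
          (1 / ((z - inverse z) * w $ 0)) \<cdot>\<^sub>v (M 1 False *\<^sub>v w + (- inverse z) \<cdot>\<^sub>v w)"
        by (simp add: smult_smult_assoc)
      with W'(4)[OF W'(3)[OF MW[OF w(1)] W'(4)[OF w(1)]]] show ?thesis by metis
    qed
    have "v \<in> W" if v: "v \<in> carrier_vec 2" for v
    proof -
      have "v = v $ 0 \<cdot>\<^sub>v unit_vec 2 0 + v $ 1 \<cdot>\<^sub>v unit_vec 2 1"
        using v by (intro eq_vecI) (auto simp: less_2_cases_iff)
      with W'(3)[OF W'(4)[OF e] W'(4)[OF e1[OF e]]] show ?thesis by metis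
    qed
    with W'(1) show ?thesis by blast
  qed
  with rep have "irreducible_representation G 2 (lift M)"
    by (auto simp: irreducible_representation_def)
  moreover have "planar_char z = char_of_rep G (lift M)"
    by (rule class_function_eqI)
      (simp_all add: planar_char_elt[OF z(1)] char_of_rep_def lift_elt[of M, OF period],
       simp_all add: planar_char_def M_def mat_trace_def numeral_2_eq_2)
  ultimately show ?thesis unfolding Irr_def by blast
qed

text \<open>An eigenvector \<open>v\<close> of the rotation \<open>r\<close> and its reflection \<open>t v\<close> span an invariant subspace, so
  \<open>d \<le> 2\<close>. The traces need no basis: \<open>\<rho> (r^k) + \<rho> (r^-k)\<close> commutes with \<open>\<rho>\<close>, hence is the scalar
  \<open>\<mu>^k + \<mu>^-k\<close>, which yields the traces of the rotations and a recurrence for those of the reflections.\<close>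

lemma irreducible_char_cases:
  assumes irr: "irreducible_representation G d \<rho>"
  obtains (linear) \<alpha> \<beta> where "\<alpha> ^ n = 1" "\<alpha>\<^sup>2 = 1" "\<beta>\<^sup>2 = 1" "char_of_rep G \<rho> = linear_char \<alpha> \<beta>"
    | (planar) z where "z ^ n = 1" "z\<^sup>2 \<noteq> 1" "char_of_rep G \<rho> = planar_char z"
proof -
  have rep: "representation G d \<rho>" and d: "d > 0"
    using irr by (auto simp: irreducible_representation_def)
  define P where "P k b = \<rho> (elt k b)" for k b
  have P [simp]: "P k b \<in> carrier_mat d d" for k b
    unfolding P_def using rep by (rule representation_carrier_mat) simp
  have PP: "P k b * P l c = P (k + (if b then - l else l)) (b \<noteq> c)" for k b l c
    unfolding P_def by (simp add: elt_mult flip: representation_mult[OF rep])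
  have P1: "P 0 False = 1\<^sub>m d"
    using representation_one[OF is_group rep] by (simp add: P_def elt_one)
  have \<rho>P: "\<exists>k b. g = elt k b \<and> \<rho> g = P k b" if "g \<in> carrier G" for g
    using that unfolding P_def by (metis eltE)
  obtain \<mu> where "\<mu> \<in> spectrum (P 1 False)"
    using spectrum_non_empty[OF P d] by blast
  then obtain v where v: "v \<in> carrier_vec d" "v \<noteq> 0\<^sub>v d" "P 1 False *\<^sub>v v = \<mu> \<cdot>\<^sub>v v"
    using carrier_matD(1)[OF P] by (auto simp: spectrum_def eigenvalue_def eigenvector_def)
  have Pw: "P k b *\<^sub>v (P l c *\<^sub>v w) = P (k + (if b then - l else l)) (b \<noteq> c) *\<^sub>v w"
    if "w \<in> carrier_vec d" for k b l c w
    using that by (simp add: PP flip: assoc_mult_mat_vec[OF P P])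
  have pow: "P (int m) False *\<^sub>v v = \<mu> ^ m \<cdot>\<^sub>v v" for m
  proof (induction m)
    case 0
    then show ?case using v by (simp add: P1)
  next
    case (Suc m)
    have "P (int (Suc m)) False *\<^sub>v v = P 1 False *\<^sub>v (P (int m) False *\<^sub>v v)"
      using v by (simp add: Pw)
    also have "\<dots> = \<mu> ^ m \<cdot>\<^sub>v (\<mu> \<cdot>\<^sub>v v)"
      using v by (simp add: Suc mult_mat_vec[OF P])
    finally show ?case by (simp add: smult_smult_assoc mult.commute)
  qed
  have smult_v: "a = b" if "a \<cdot>\<^sub>v v = b \<cdot>\<^sub>v v" for a b
  proof -
    obtain i where "i < d" "v $ i \<noteq> 0"
      using v by (metis carrier_vecD eq_vecI index_zero_vec)
    with arg_cong[OF that, of "\<lambda>x. x $ i"] v(1) show ?thesis by auto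
  qed
  have P_cong: "P (k mod int n) b = P k b" for k b
    unfolding P_def by (subst elt_cong[of "k mod int n" k]) auto
  have \<mu>n: "\<mu> ^ n = 1"
  proof (rule smult_v)
    show "\<mu> ^ n \<cdot>\<^sub>v v = 1 \<cdot>\<^sub>v v"
      using pow[of n] P_cong[of "int n" False, symmetric] v P1 by simp
  qed
  then have \<mu>0: "\<mu> \<noteq> 0" using n_pos by (auto simp: power_0_left)
  have Pv: "P k False *\<^sub>v v = \<mu> powi k \<cdot>\<^sub>v v" for k
  proof -
    have "P (k mod int n) False *\<^sub>v v = \<mu> powi (k mod int n) \<cdot>\<^sub>v v"
      using pow[of "nat (k mod int n)"] n_pos by (simp add: power_int_def)
    then show ?thesis
      by (simp add: P_cong power_int_mod_root_of_unity[OF \<mu>n n_pos])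
  qed
  \<comment> \<open>The image of \<open>v\<close> under \<open>t\<close> is an eigenvector of
    \<open>r\<close> for \<open>inverse \<mu>\<close>; reflections exchange the lines of
    \<open>v\<close> and \<open>u\<close>.\<close>
  define u where "u = P 0 True *\<^sub>v v"
  have u: "u \<in> carrier_vec d" unfolding u_def using P v(1) by (rule mult_mat_vec_carrier)
  have Pu: "P k True *\<^sub>v u = \<mu> powi k \<cdot>\<^sub>v v" for k
    using Pw[of v k True 0 True] v Pv by (simp add: u_def)
  have P_refl: "P k True *\<^sub>v w = P 0 True *\<^sub>v (P (- k) False *\<^sub>v w)" if "w \<in> carrier_vec d" for k w
    using that by (simp add: Pw)
  have Pv': "P k True *\<^sub>v v = \<mu> powi (- k) \<cdot>\<^sub>v u" for k
    using v(1) by (simp add: P_refl[of v k] Pv mult_mat_vec[OF P] u_def)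
  have Pu': "P k False *\<^sub>v u = \<mu> powi (- k) \<cdot>\<^sub>v u" for k
    using Pw[of v k False 0 True] Pv'[of k] v by (simp add: u_def)
  show thesis
  proof (cases "\<mu>\<^sup>2 = 1")
    case True
    have neg: "\<mu> powi (- k) = \<mu> powi k" for k
      by (rule power_int_minus_square_one[OF True])
    \<comment> \<open>Now \<open>r\<close> acts on \<open>v\<close> and \<open>u\<close> by the same
      scalar, so \<open>v + u\<close>, which \<open>t\<close> fixes, is a common eigenvector with
      \<open>\<beta> = 1\<close>. If it vanishes, \<open>t\<close> negates \<open>v\<close>, and
      \<open>v\<close> serves with \<open>\<beta> = - 1\<close>.\<close>
    obtain \<beta> w where \<beta>: "\<beta>\<^sup>2 = 1" and w: "w \<in> carrier_vec d" "w \<noteq> 0\<^sub>v d"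
      and Pw: "\<And>k b. P k b *\<^sub>v w = (\<mu> powi k * (if b then \<beta> else 1)) \<cdot>\<^sub>v w"
    proof (cases "v + u = 0\<^sub>v d")
      case True
      have uv: "u = (- 1) \<cdot>\<^sub>v v"
      proof (rule eq_vecI)
        fix i assume "i < dim_vec ((- 1) \<cdot>\<^sub>v v)"
        then show "u $ i = ((- 1) \<cdot>\<^sub>v v) $ i"
          using arg_cong[OF True, of "\<lambda>x. x $ i"] u v(1) by (simp add: eq_neg_iff_add_eq_0 add.commute)
      qed (use u v in auto)
      have "P k b *\<^sub>v v = (\<mu> powi k * (if b then - 1 else 1)) \<cdot>\<^sub>v v" for k b
        by (cases b) (simp_all add: Pv Pv' neg uv smult_smult_assoc)
      then show thesis using that[of "- 1" v] v by simp
    next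
      case False
      \<comment> \<open>The trivial conditional keeps the shape of the goal for
        \<open>\<beta> = 1\<close>.\<close>
      have "P k b *\<^sub>v (v + u) = (\<mu> powi k * (if b then 1 else 1)) \<cdot>\<^sub>v (v + u)" for k b
        using u v(1) comm_add_vec[OF u v(1)]
        by (cases b) (simp_all add: mult_add_distrib_mat_vec[OF P v(1) u] Pv Pv' Pu Pu' neg
          flip: smult_add_distrib_vec)
      then show thesis using that[of 1 "v + u"] False u v(1) by simp
    qed
    define f where "f = linear_char \<mu> \<beta>"
    have f: "f (elt k b) = \<mu> powi k * (if b then \<beta> else 1)" for k b
      by (simp add: f_def linear_char_elt[OF \<mu>n])
    have "\<rho> g *\<^sub>v w = f g \<cdot>\<^sub>v w" if "g \<in> carrier G" for g
      using \<rho>P[OF that] by (auto simp: Pw f)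
    from mat_trace_irreducible_common_eigenvector[OF irr w this]
    have "char_of_rep G \<rho> = linear_char \<mu> \<beta>"
      by (intro class_function_eqI) (auto simp: char_of_rep_def f_def linear_char_def)
    with linear \<mu>n True \<beta> show thesis by blast
  next
    case False
    define c where "c k = \<mu> powi k + \<mu> powi (- k)" for k
    \<comment> \<open>Rotations commute with both summands, and conjugation by a reflection
      exchanges the two.\<close>
    have scalar: "P k False + P (- k) False = c k \<cdot>\<^sub>m 1\<^sub>m d" for k
    proof (rule schur_scalar[OF irr _ _ v(1,2)])
      show "P k False + P (- k) False \<in> carrier_mat d d" by (simp add: add_carrier_mat)
      show "(P k False + P (- k) False) * \<rho> g = \<rho> g * (P k False + P (- k) False)"
        if g: "g \<in> carrier G" for g
      proof -
        obtain l b where "\<rho> g = P l b" using \<rho>P[OF g] by blast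
        moreover have "P (k + l) b + P (l - k) b = P (l - k) b + P (k + l) b"
          by (rule comm_add_mat[OF P P])
        ultimately show ?thesis
          by (cases b) (simp_all add: add_mult_distrib_mat[OF P P P] mult_add_distrib_mat[OF P P P] PP add.commute)
      qed
      show "(P k False + P (- k) False) *\<^sub>v v = c k \<cdot>\<^sub>v v"
        using v(1) by (simp add: add_mult_distrib_mat_vec[OF P P] Pv c_def add_smult_distrib_vec)
    qed
    define \<tau> where "\<tau> k b = mat_trace (P k b)" for k b
    \<comment> \<open>The matrices of \<open>r^k\<close> and \<open>r^-k\<close> are the products of
      those of \<open>r^k t\<close> and \<open>t\<close> in the two orders, so their traces agree;
      each is half the trace of the scalar matrix.\<close>
    have rot: "2 * \<tau> k False = of_nat d * c k" for k
    proof -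
      have "\<tau> (- k) False = mat_trace (P 0 True * P k True)"
        by (simp add: \<tau>_def PP)
      also have "\<dots> = mat_trace (P k True * P 0 True)"
        by (rule mat_trace_comm[OF P P])
      also have "\<dots> = \<tau> k False"
        by (simp add: \<tau>_def PP)
      finally have "2 * \<tau> k False = mat_trace (P k False + P (- k) False)"
        by (simp add: \<tau>_def mat_trace_add[OF P P])
      then show ?thesis
        by (simp add: scalar mat_trace_smult[of _ d] mat_trace_one mult.commute)
    qed
    \<comment> \<open>Cyclicity of the trace makes \<open>\<tau> k True\<close> depend only on the
      parity of \<open>k\<close>. The recurrence \<open>sum\<close>, used at \<open>k\<close> and at
      \<open>k - 1\<close>, then multiplies the trace by \<open>(c 1)^2 / 4\<close>, and this factor
      is not 1.\<close>
    have refl: "\<tau> k True = 0" for k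
    proof -
      have step: "\<tau> (k + 1) True = \<tau> (k - 1) True" for k
      proof -
        have "\<tau> (k + 1) True = mat_trace (P 1 False * P k True)" by (simp add: \<tau>_def PP add.commute)
        also have "\<dots> = mat_trace (P k True * P 1 False)" by (rule mat_trace_comm[OF P P])
        also have "\<dots> = \<tau> (k - 1) True" by (simp add: \<tau>_def PP)
        finally show ?thesis .
      qed
      have sum: "\<tau> (k + 1) True + \<tau> (k - 1) True = c 1 * \<tau> k True" for k
      proof -
        have "(P 1 False + P (- 1) False) * P k True = P (k + 1) True + P (k - 1) True"
          by (simp add: add_mult_distrib_mat[OF P P P] PP add.commute)
        then have "P (k + 1) True + P (k - 1) True = c 1 \<cdot>\<^sub>m P k True"
          by (simp add: scalar mult_smult_assoc_mat[OF one_carrier_mat P] left_mult_one_mat[OF P])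
        from arg_cong[OF this, of mat_trace] show ?thesis
          by (simp add: \<tau>_def mat_trace_add[OF P P] mat_trace_smult[OF P])
      qed
      have e: "2 * \<tau> (k - 1) True = c 1 * \<tau> k True" "2 * \<tau> k True = c 1 * \<tau> (k - 1) True"
        using sum[of k] sum[of "k - 1"] step[of k] step[of "k - 1"] by simp_all
      have "4 * \<tau> k True = 2 * (2 * \<tau> k True)" by simp
      also have "\<dots> = c 1 * (2 * \<tau> (k - 1) True)" by (simp add: e(2))
      also have "\<dots> = (c 1)\<^sup>2 * \<tau> k True" by (simp add: e(1) power2_eq_square)
      finally have "4 * \<tau> k True = (c 1)\<^sup>2 * \<tau> k True" .
      moreover have "(c 1)\<^sup>2 - 4 = (\<mu> - inverse \<mu>)\<^sup>2"
        using \<mu>0 by (simp add: c_def power2_eq_square algebra_simps)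
      moreover have "\<mu> - inverse \<mu> \<noteq> 0"
        using False \<mu>0 by (auto simp: field_simps power2_eq_square)
      ultimately have "((c 1)\<^sup>2 - 4) * \<tau> k True = 0" "(c 1)\<^sup>2 - 4 \<noteq> 0"
        by (simp_all add: algebra_simps)
      then show ?thesis by simp
    qed
    have "d \<le> card {v, u}"
    proof (rule irreducible_representation_dim_le[OF irr _ _ _ v(2)])
      fix g s assume "g \<in> carrier G" and s: "s \<in> {v, u}"
      then obtain k b where "\<rho> g = P k b" using \<rho>P by blast
      then show "\<exists>c. \<exists>s'\<in>{v, u}. \<rho> g *\<^sub>v s = c \<cdot>\<^sub>v s'"
        using s by (cases b) (auto simp: Pv Pu Pv' Pu')
    qed (use u v in auto)
    also have "\<dots> \<le> 2" by (simp add: card_insert_if)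
    finally have "d \<le> 2" .
    \<comment> \<open>In dimension one the matrix of \<open>t\<close> would be its trace, zero,
      although its square is the identity.\<close>
    moreover have "d \<noteq> 1"
    proof
      assume d1: "d = 1"
      then have dims: "P k b \<in> carrier_mat 1 1" for k b using P[of k b] by simp
      have "P 0 True $$ (0, 0) = 0"
        using refl[of 0] dims[of 0 True] by (simp add: \<tau>_def mat_trace_def)
      moreover have "(P 0 True * P 0 True) $$ (0, 0) = P 0 True $$ (0, 0) * P 0 True $$ (0, 0)"
        using dims[of 0 True] by (simp add: scalar_prod_def)
      moreover have "(P 0 True * P 0 True) $$ (0, 0) = 1"
        using d1 by (simp add: PP P1)
      ultimately show False by simp
    qed
    ultimately have "d = 2" using d by linarith
    then have "\<tau> k b = (if b then 0 else c k)" for k b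
      using rot[of k] refl[of k] by simp
    then have "char_of_rep G \<rho> = planar_char \<mu>"
      by (intro class_function_eqI)
        (simp_all add: planar_char_elt[OF \<mu>n], simp_all add: char_of_rep_def \<tau>_def P_def c_def planar_char_def)
    with planar \<mu>n False show thesis by blast
  qed
qed

section \<open>Sums over the irreducible characters\<close>

lemma Irr_eq:
  "Irr G = (\<lambda>(\<alpha>, \<beta>). linear_char \<alpha> \<beta>) ` ({\<alpha>. \<alpha> ^ n = 1 \<and> \<alpha>\<^sup>2 = 1} \<times> {\<beta>. \<beta>\<^sup>2 = 1})
    \<union> planar_char ` {z. z ^ n = 1 \<and> z\<^sup>2 \<noteq> 1}" (is "_ = ?R")
proof
  show "Irr G \<subseteq> ?R"
    unfolding Irr_def by (auto elim!: irreducible_char_cases)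
  show "?R \<subseteq> Irr G"
    using linear_char_in_Irr planar_char_in_Irr by auto
qed

lemma linear_char_inj:
  "inj_on (\<lambda>(\<alpha>, \<beta>). linear_char \<alpha> \<beta>) ({\<alpha>. \<alpha> ^ n = 1 \<and> \<alpha>\<^sup>2 = 1} \<times> {\<beta>. \<beta>\<^sup>2 = 1})"
proof (rule inj_onI, clarify)
  fix \<alpha> \<beta> \<alpha>' \<beta>'
  assume "\<alpha> ^ n = 1" "\<alpha>' ^ n = 1" and eq: "linear_char \<alpha> \<beta> = linear_char \<alpha>' \<beta>'"
  then have "\<alpha> powi k * (if b then \<beta> else 1) = \<alpha>' powi k * (if b then \<beta>' else 1)" for k b
    by (metis linear_char_elt)
  from this[of 1 False] this[of 0 True] show "\<alpha> = \<alpha>' \<and> \<beta> = \<beta>'" by simp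
qed

lemma planar_char_eq_iff:
  assumes "z ^ n = 1" "w ^ n = 1"
  shows "planar_char z = planar_char w \<longleftrightarrow> w = z \<or> w = inverse z"
proof
  have 0: "z \<noteq> 0" "w \<noteq> 0" using assms n_pos by (auto simp: power_0_left)
  assume "planar_char z = planar_char w"
  then have "planar_char z (elt 1 False) = planar_char w (elt 1 False)" by simp
  then have "z + inverse z = w + inverse w"
    by (simp add: planar_char_elt assms)
  \<comment> \<open>Clearing denominators in the equality of the values at \<open>r\<close> gives
    this factorisation.\<close>
  then have "(w - z) * (w * z - 1) = 0"
    using 0 by (simp add: field_simps)
  then show "w = z \<or> w = inverse z"
    by (metis eq_iff_diff_eq_0 inverse_unique mult.commute mult_eq_0_iff)
next
  assume "w = z \<or> w = inverse z"
  then show "planar_char z = planar_char w"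
    by (intro class_function_eqI)
      (auto simp: planar_char_elt assms power_int_inverse power_int_minus, auto simp: planar_char_def)
qed

text \<open>The map \<open>planar_char\<close> is two-to-one, with fibres
  \<open>{z, inverse z}\<close>; halving the sum over all admissible \<open>z\<close> avoids a
  choice of representatives.\<close>

lemma sum_Irr:
  fixes H :: "('a \<Rightarrow> complex) \<Rightarrow> complex"
  shows "(\<Sum>\<chi>\<in>Irr G. H \<chi>) =
    (\<Sum>\<alpha> | \<alpha> ^ n = 1 \<and> \<alpha>\<^sup>2 = 1. \<Sum>\<beta> | \<beta>\<^sup>2 = 1. H (linear_char \<alpha> \<beta>)) +
    (\<Sum>z | z ^ n = 1 \<and> z\<^sup>2 \<noteq> 1. H (planar_char z)) / 2"
proof -
  let ?S = "{\<alpha>::complex. \<alpha> ^ n = 1 \<and> \<alpha>\<^sup>2 = 1}" and ?B = "{\<beta>::complex. \<beta>\<^sup>2 = 1}"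
    and ?Z = "{z::complex. z ^ n = 1 \<and> z\<^sup>2 \<noteq> 1}" and ?lin = "\<lambda>(\<alpha>, \<beta>). linear_char \<alpha> \<beta>"
  have fin: "finite ?S" "finite ?B" "finite ?Z"
    using finite_roots_unity[of n] finite_roots_unity[of 2] n_pos by auto
  have disj: "?lin ` (?S \<times> ?B) \<inter> planar_char ` ?Z = {}"
  proof -
    \<comment> \<open>The values at the identity are 1 and 2.\<close>
    have "linear_char \<alpha> \<beta> \<noteq> planar_char z" if "\<alpha> ^ n = 1" "z ^ n = 1" for \<alpha> \<beta> z
      using linear_char_elt[OF that(1), of \<beta> 0 False] planar_char_elt[OF that(2), of 0 False] by auto
    then show ?thesis by auto
  qed
  have planar: "(\<Sum>z\<in>?Z. H (planar_char z)) = 2 * (\<Sum>\<chi>\<in>planar_char ` ?Z. H \<chi>)"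
  proof -
    have "(\<Sum>w\<in>{w\<in>?Z. planar_char w = \<chi>}. H (planar_char w)) = 2 * H \<chi>"
      if \<chi>: "\<chi> \<in> planar_char ` ?Z" for \<chi>
    proof -
      obtain z where z: "z \<in> ?Z" "\<chi> = planar_char z" using \<chi> by blast
      then have 0: "z \<noteq> 0" using n_pos by (auto simp: power_0_left)
      have "planar_char w = \<chi> \<longleftrightarrow> w = z \<or> w = inverse z" if "w \<in> ?Z" for w
        using planar_char_eq_iff[of z w] that z by (metis (mono_tags, lifting) mem_Collect_eq)
      then have "{w\<in>?Z. planar_char w = \<chi>} = {w\<in>?Z. w = z \<or> w = inverse z}" by blast
      also have "\<dots> = {z, inverse z}"
        using z by (auto simp: power_inverse)
      finally have eq: "{w\<in>?Z. planar_char w = \<chi>} = {z, inverse z}" .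
      have "z \<noteq> inverse z"
        using z 0 by (auto simp: field_simps power2_eq_square)
      then have "card {w\<in>?Z. planar_char w = \<chi>} = 2" unfolding eq by simp
      then show ?thesis by simp
    qed
    then have "(\<Sum>\<chi>\<in>planar_char ` ?Z. \<Sum>w\<in>{w\<in>?Z. planar_char w = \<chi>}. H (planar_char w)) =
        (\<Sum>\<chi>\<in>planar_char ` ?Z. 2 * H \<chi>)"
      by (rule sum.cong[OF HOL.refl])
    then show ?thesis
      using sum.image_gen[OF fin(3), of "\<lambda>z. H (planar_char z)" planar_char]
      by (simp add: sum_distrib_left)
  qed
  have "(\<Sum>\<chi>\<in>Irr G. H \<chi>) = (\<Sum>\<chi>\<in>?lin ` (?S \<times> ?B). H \<chi>) + (\<Sum>\<chi>\<in>planar_char ` ?Z. H \<chi>)"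
    unfolding Irr_eq using fin disj by (intro sum.union_disjoint) auto
  also have "(\<Sum>\<chi>\<in>?lin ` (?S \<times> ?B). H \<chi>) = (\<Sum>p\<in>?S \<times> ?B. H (?lin p))"
    by (simp add: sum.reindex[OF linear_char_inj])
  also have "\<dots> = (\<Sum>\<alpha>\<in>?S. \<Sum>\<beta>\<in>?B. H (linear_char \<alpha> \<beta>))"
    by (simp add: sum.cartesian_product split_beta)
  finally show ?thesis by (simp add: planar)
qed

text \<open>The roots with \<open>z^2 \<noteq> 1\<close> are all \<open>n\<close>-th roots of unity
  without those of square 1, so the planar part is a difference of two complete power sums.\<close>

lemma sum_Irr_elt:
  defines "m \<equiv> gcd n 2"
  defines "E \<equiv> \<lambda>k l. if int m dvd k + l then int m else 0"
  shows "(\<Sum>\<chi>\<in>Irr G. (\<chi> \<one>)\<^sup>2 * \<chi> (elt k b) * cnj (\<chi> (elt l c))) = of_int (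
    (if b = c then 2 * E k l else 0) + (if \<not> b \<and> \<not> c then
      4 * int n * (of_bool (int n dvd k + l) + of_bool (int n dvd k - l)) - 8 * E k l else 0))"
proof -
  let ?U = "{z::complex. z ^ n = 1}"
  let ?S = "{\<alpha>::complex. \<alpha> ^ n = 1 \<and> \<alpha>\<^sup>2 = 1}" and ?B = "{\<beta>::complex. \<beta>\<^sup>2 = 1}"
    and ?Z = "{z::complex. z ^ n = 1 \<and> z\<^sup>2 \<noteq> 1}"
  let ?H = "\<lambda>\<chi>. (\<chi> \<one>)\<^sup>2 * \<chi> (elt k b) * cnj (\<chi> (elt l c))"
  have m: "m > 0" by (simp add: m_def)
  have B: "?B = {1, - 1}" by (auto simp: power2_eq_1_iff)
  have nonzero: "z \<noteq> 0" if "z ^ n = 1" for z :: complex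
    using that n_pos by (auto simp: power_0_left)
  have E: "(\<Sum>\<alpha>\<in>?S. \<alpha> powi (k + l)) = of_int (E k l)"
    unfolding square_one_roots_of_unity m_def[symmetric] sum_powi_roots_of_unity[OF m]
    by (simp add: E_def)
  \<comment> \<open>For two rotations or two reflections the factors \<open>\<beta>\<close>
    contribute 1 each time; in the mixed case a single \<open>\<beta>\<close> remains and cancels
    over \<open>1\<close> and \<open>- 1\<close>.\<close>
  have lin: "(\<Sum>\<beta>\<in>?B. ?H (linear_char \<alpha> \<beta>)) = (if b = c then 2 else 0) * \<alpha> powi (k + l)"
    if "\<alpha> \<in> ?S" for \<alpha>
  proof -
    have \<alpha>: "\<alpha> ^ n = 1" "\<alpha>\<^sup>2 = 1" using that by auto
    have "cnj \<alpha> = \<alpha>"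
      using \<alpha>(2) by (auto simp: power2_eq_1_iff)
    then show ?thesis
      unfolding B elt_one[symmetric]
      by (simp add: linear_char_elt[OF \<alpha>(1)] power_int_add nonzero[OF \<alpha>(1)])
  qed
  \<comment> \<open>The expanded product of \<open>z^k + z^-k\<close> with the conjugate of
    \<open>z^l + z^-l\<close>; the factor 4 below is the squared degree.\<close>
  let ?q = "\<lambda>z::complex. z powi (k + l) + z powi (k - l) + z powi (l - k) + z powi (- (k + l))"
  have planar: "?H (planar_char z) = (if \<not> b \<and> \<not> c then 4 * ?q z else 0)" if "z ^ n = 1" for z
    unfolding elt_one[symmetric] using nonzero[OF that]
    by (simp add: planar_char_elt[OF that] cnj_root_of_unity[OF that n_pos] power_int_inverse
      power_int_add power_int_diff power_int_minus field_simps)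
  have q_U: "(\<Sum>z\<in>?U. ?q z) = of_int (2 * int n * (of_bool (int n dvd k + l) + of_bool (int n dvd k - l)))"
  proof -
    have "int n dvd l - k \<longleftrightarrow> int n dvd k - l" "int n dvd - (k + l) \<longleftrightarrow> int n dvd k + l"
      by (simp_all only: dvd_minus_iff dvd_diff_commute)
    then show ?thesis
      by (simp add: sum.distrib sum_powi_roots_of_unity[OF n_pos] del: minus_add_distrib)
  qed
  \<comment> \<open>When \<open>z^2 = 1\<close>, signs of exponents are irrelevant and the four
    terms coincide.\<close>
  have q_S: "(\<Sum>z\<in>?S. ?q z) = of_int (4 * E k l)"
  proof -
    have "?q z = 4 * z powi (k + l)" if "z \<in> ?S" for z
    proof -
      have z: "z ^ n = 1" "z\<^sup>2 = 1" using that by auto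
      have "z powi (k - l) = z powi (k + l)" "z powi (l - k) = z powi (k + l)"
        using power_int_minus_square_one[OF z(2), of l] power_int_minus_square_one[OF z(2), of k]
          power_int_add[of z k "- l"] power_int_add[of z k l] power_int_add[of z l "- k"] nonzero[OF z(1)]
        by (simp_all add: mult.commute)
      then show ?thesis by (simp only: power_int_minus_square_one[OF z(2)]) simp
    qed
    then have "(\<Sum>z\<in>?S. ?q z) = 4 * (\<Sum>z\<in>?S. z powi (k + l))"
      unfolding sum_distrib_left by (rule sum.cong[OF HOL.refl])
    then show ?thesis by (simp add: E)
  qed
  have q_Z: "(\<Sum>z\<in>?Z. ?q z) = (\<Sum>z\<in>?U. ?q z) - (\<Sum>z\<in>?S. ?q z)"
  proof -
    have "?Z = ?U - ?S" by auto
    then show ?thesis using finite_roots_unity[of n] n_pos by (simp only:) (intro sum_diff, auto)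
  qed
  have "(\<Sum>\<chi>\<in>Irr G. ?H \<chi>) = (\<Sum>\<alpha>\<in>?S. (if b = c then 2 else 0) * \<alpha> powi (k + l)) +
      (\<Sum>z\<in>?Z. if \<not> b \<and> \<not> c then 4 * ?q z else 0) / 2"
    unfolding sum_Irr using lin planar by (intro arg_cong2[where f = "(+)"] arg_cong2[where f = "(/)"] sum.cong) auto
  also have "\<dots> = (if b = c then 2 else 0) * of_int (E k l) +
      (if \<not> b \<and> \<not> c then 2 * (\<Sum>z\<in>?Z. ?q z) else 0)"
    by (simp add: E flip: sum_distrib_left)
  finally show ?thesis
    unfolding q_Z q_U q_S by simp
qed

lemma AM_Z_eq:
  assumes "n \<ge> 3"
  shows "AM_Z G = 1 + 3 * (1 - real (gcd n 2) / real n)\<^sup>2"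
proof -
  define E A B where "E k l = (if int (gcd n 2) dvd int k + int l then int (gcd n 2) else 0)"
    and "A k l = (of_bool (int n dvd int k + int l) :: int)"
    and "B k l = (of_bool (int n dvd int k - int l) :: int)" for k l
  have sum_carrier: "(\<Sum>x\<in>carrier G. f x) = (\<Sum>k<n. f (elt (int k) True) + f (elt (int k) False))"
    for f :: "'a \<Rightarrow> real"
  proof -
    have "(\<Sum>x\<in>carrier G. f x) = (\<Sum>(k, b)\<in>{..<n} \<times> UNIV. f (elt (int k) b))"
      using sum.reindex_bij_betw[OF bij_betw_elt, of f] by (simp add: split_beta)
    then show ?thesis by (simp add: UNIV_bool flip: sum.cartesian_product)
  qed
  define F where "F x y = cmod (\<Sum>\<chi>\<in>Irr G. (\<chi> \<one>)\<^sup>2 * \<chi> x * cnj (\<chi> y))" for x y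
  \<comment> \<open>The two mixed terms vanish; the rotations give the first absolute value and the
    reflections the second.\<close>
  have F: "F (elt (int k) True) (elt (int l) True) + F (elt (int k) True) (elt (int l) False)
      + (F (elt (int k) False) (elt (int l) True) + F (elt (int k) False) (elt (int l) False))
      = of_int (\<bar>4 * int n * (A k l + B k l) - 6 * E k l\<bar> + \<bar>2 * E k l\<bar>)" for k l
  proof -
    have "2 * e + (a - 8 * e) = a - 6 * e" for a e :: int by simp
    then show ?thesis
      unfolding F_def sum_Irr_elt norm_of_int E_def[symmetric] A_def[symmetric] B_def[symmetric]
      by simp
  qed
  have "(\<Sum>x\<in>carrier G. \<Sum>y\<in>carrier G. F x y) =
      (\<Sum>k<n. \<Sum>l<n. of_int (\<bar>4 * int n * (A k l + B k l) - 6 * E k l\<bar> + \<bar>2 * E k l\<bar>))"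
    unfolding sum_carrier F[symmetric] by (simp only: sum.distrib)
  also have "\<dots> = of_int (16 * (int n)\<^sup>2 - 24 * int (gcd n 2) * int n + 12 * (int (gcd n 2))\<^sup>2)"
    unfolding E_def A_def B_def sum_abs_dihedral[OF assms, symmetric] by simp
  \<comment> \<open>With \<open>m = gcd n 2\<close>, division by \<open>4n^2\<close> leaves
    \<open>4 - 6m/n + 3(m/n)^2\<close>, which is the completed square.\<close>
  also have "\<dots> / (real (2 * n))\<^sup>2 = 1 + 3 * (1 - real (gcd n 2) / real n)\<^sup>2"
    using n_pos by (simp add: field_simps power2_eq_square)
  finally show ?thesis
    by (simp add: AM_Z_eq_sum_carrier[OF finite_carrier] order_eq F_def)
qed

end

section \<open>The presented group as an instance\<close>

lemma dihedral_dihedral_group: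
  fixes n :: nat
  assumes "n > 0"
  defines "cl \<equiv> gword_class (dihedral_relations n)"
  shows "dihedral (dihedral_group n) n (cl [(Rot, True)]) (cl [(Ref, True)])"
proof -
  let ?G = "dihedral_group n"
  interpret group ?G
    unfolding dihedral_group_def by (rule group_presented_group)
  have cl: "cl u \<in> carrier ?G" "cl u \<otimes>\<^bsub>?G\<^esub> cl v = cl (u @ v)" for u v
    by (simp_all add: cl_def dihedral_group_def carrier_presented_group mult_presented_group)
  have one: "\<one>\<^bsub>?G\<^esub> = cl []"
    by (simp add: cl_def dihedral_group_def one_presented_group)
  have rel: "cl u = cl v" if "(u, v) \<in> dihedral_relations n" for u v
    using that unfolding cl_def gword_class_eq_iff by (rule gword_eq.relator)
  have pow: "cl [(Rot, True)] [^]\<^bsub>?G\<^esub> k = cl (replicate k (Rot, True))" for k :: nat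
    by (induction k) (simp_all add: one cl replicate_append_same)
  have "cl [(Rot, False)] \<otimes>\<^bsub>?G\<^esub> cl [(Rot, True)] = \<one>\<^bsub>?G\<^esub>"
    using gword_eq.cancel[of "dihedral_relations n" Rot False]
    by (simp add: cl one) (simp add: cl_def gword_class_eq_iff)
  then have r_inv: "inv\<^bsub>?G\<^esub> cl [(Rot, True)] = cl [(Rot, False)]"
    by (intro inv_equality cl)
  define f where "f = (\<lambda>(k, b). cl [(Rot, True)] [^]\<^bsub>?G\<^esub> (k::nat) \<otimes>\<^bsub>?G\<^esub> (if b then cl [(Ref, True)] else \<one>\<^bsub>?G\<^esub>))"
  have f: "f (k, b) = cl (replicate k (Rot, True) @ (if b then [(Ref, True)] else []))" for k b
    by (simp add: f_def pow cl one)
  \<comment> \<open>Equal classes have equal affine maps modulo \<open>n\<close>, and these recover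
    both \<open>k\<close> and \<open>b\<close>.\<close>
  have inj: "inj_on f ({..<n} \<times> UNIV)"
  proof (rule inj_onI, clarify)
    fix k b l c assume "k < n" "l < n" and eq: "f (k, b) = f (l, c)"
    from eq have "gword_eq (dihedral_relations n)
        (replicate k (Rot, True) @ (if b then [(Ref, True)] else []))
        (replicate l (Rot, True) @ (if c then [(Ref, True)] else []))"
      unfolding f by (simp add: cl_def gword_class_eq_iff)
    from dihedral_val_gword_eq[OF this] \<open>k < n\<close> \<open>l < n\<close> show "k = l \<and> b = c"
      by (cases b; cases c) (auto simp: dihedral_val_append dihedral_val_replicate)
  qed
  \<comment> \<open>Surjectivity follows by counting, as the order is already known to be
    \<open>2 * n\<close>.\<close>
  have "f ` ({..<n} \<times> UNIV) = carrier ?G"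
  proof (rule card_subset_eq)
    have "card (carrier ?G) = 2 * n"
      using order_dihedral_group[OF assms(1)] by (simp add: Coset.order_def)
    then show "finite (carrier ?G)" "card (f ` ({..<n} \<times> UNIV)) = card (carrier ?G)"
      using assms(1) by (auto simp: card_image[OF inj] card_cartesian_product intro: card_ge_0_finite)
    show "f ` ({..<n} \<times> UNIV) \<subseteq> carrier ?G"
      using cl(1) by (auto simp: f)
  qed
  with inj have "bij_betw f ({..<n} \<times> UNIV) (carrier ?G)"
    by (simp add: bij_betw_def)
  then show ?thesis
    unfolding f_def
    by unfold_locales
      (use assms(1) in \<open>auto simp: cl(1) pow one r_inv cl(2) dihedral_relations_def intro!: rel\<close>)
qed

theorem mainTheorem3:
  fixes n :: nat
  assumes "n \<ge> 3"
  shows "(even n \<and> n \<ge> 4 \<longrightarrow> AM_Z (dihedral_group n) = 1 + 3 * (1 - 2 / real n)\<^sup>2)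
    \<and> (odd n \<and> n \<ge> 3 \<longrightarrow> AM_Z (dihedral_group n) = 1 + 3 * (1 - 1 / real n)\<^sup>2)"
proof -
  \<comment> \<open>Both parities at once: \<open>gcd n 2\<close> is 2 for even \<open>n\<close> and
    1 for odd \<open>n\<close>.\<close>
  have "AM_Z (dihedral_group n) = 1 + 3 * (1 - real (gcd n 2) / real n)\<^sup>2"
    using assms by (intro dihedral.AM_Z_eq[OF dihedral_dihedral_group]) auto
  then show ?thesis by simp
qed

end
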